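(* The following decision problem is $\Pi^1_2$-complete: given equational bitstream specifications $E_s$ over $\Sigma_s$ and $E_t$ over $\Sigma_t$ and ground terms $s$ over $\Sigma_s$ and $t$ over $\Sigma_t$, both of sort $S$, decide whether $\mathrm{sol}(s,E_s)=\mathrm{sol}(t,E_t)$.
   Context: Sorts are $B$ (bits) and $S$ (bitstreams). A bitstream signature $\Sigma$ is a set of function symbols, each with a type $f :: s_1\times\cdots\times s_n\to s$ with $s_i,s\in\{B,S\}$, containing $0,1::B$ and the infix stream constructor $:\,::B\times S\to S$. An equational bitstream specification over $\Sigma$ is a finite set of equations between sorted terms of the same sort (terms may contain sorted variables). A stream algebra $\mathcal{A}=\langle A,[\![\cdot]\!]\rangle$ consists of $A_B=\{0,1\}$, a nonempty $A_S\subseteq\{0,1\}^{\mathbb N}$, and functions $[\![f]\!]:A_{s_1}\times\cdots\times A_{s_n}\to A_s$ for each symbol, with $[\![:]\!](x,\sigma)=x:\sigma$, $[\![0]\!]=0$, $[\![1]\!]=1$. $\mathcal A$ is a model of $E$ if both sides of every equation of $E$ have equal interpretations under every sort-respecting variable assignment into $A$. For a ground term $s$ of sort $S$, $\mathrm{sol}(s,E)=\{[\![s]\!]^{\mathcal A}\mid \mathcal A\text{ a stream algebra model of }E\}$. Instances are coded as natural numbers; $\mathcal C$-complete means every set in $\mathcal C$ many-one reduces to the problem via a partial recursive function and the problem many-one reduces to some set in $\mathcal C$. *)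

theory Defs
  imports "HOL-Library.Nat_Bijection"
begin

section \<open>Bitstream signatures and terms\<close>

datatype srt = BitSort | StreamSort

text \<open>
  Apart from the three mandatory symbols, a function symbol is a name together with its type,
  so that a signature is just a set of symbols.
\<close>

datatype symbol =
    Zero
  | One
  | Cons
  | Fun nat "srt list" srt

fun arg_sorts :: "symbol \<Rightarrow> srt list" where
  "arg_sorts Zero = []"
| "arg_sorts One = []"
| "arg_sorts Cons = [BitSort, StreamSort]"
| "arg_sorts (Fun f ss s) = ss"

fun res_sort :: "symbol \<Rightarrow> srt" where
  "res_sort Zero = BitSort"
| "res_sort One = BitSort"
| "res_sort Cons = StreamSort"
| "res_sort (Fun f ss s) = s"

definition bitstream_signature :: "symbol set \<Rightarrow> bool" where
  "bitstream_signature \<Sigma> \<longleftrightarrow> {Zero, One, Cons} \<subseteq> \<Sigma>"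

datatype trm = Var nat srt | App symbol "trm list"

inductive has_sort :: "symbol set \<Rightarrow> trm \<Rightarrow> srt \<Rightarrow> bool" for \<Sigma> where
  has_sort_Var: "has_sort \<Sigma> (Var x s) s"
| has_sort_App: "f \<in> \<Sigma> \<Longrightarrow> list_all2 (has_sort \<Sigma>) ts (arg_sorts f) \<Longrightarrow>
    has_sort \<Sigma> (App f ts) (res_sort f)"

fun ground :: "trm \<Rightarrow> bool" where
  "ground (Var x s) \<longleftrightarrow> False"
| "ground (App f ts) \<longleftrightarrow> (\<forall>t \<in> set ts. ground t)"

definition bitstream_spec :: "symbol set \<Rightarrow> (trm \<times> trm) set \<Rightarrow> bool" where
  "bitstream_spec \<Sigma> E \<longleftrightarrow>
     finite E \<and> (\<forall>(l, r) \<in> E. \<exists>s. has_sort \<Sigma> l s \<and> has_sort \<Sigma> r s)"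


section \<open>Stream algebras and solutions\<close>

text \<open>The bits 0 and 1 are \<^const>\<open>False\<close> and \<^const>\<open>True\<close>.\<close>

datatype val = BitVal bool | StreamVal "nat \<Rightarrow> bool"

fun carrier :: "(nat \<Rightarrow> bool) set \<Rightarrow> srt \<Rightarrow> val set" where
  "carrier AS BitSort = range BitVal"
| "carrier AS StreamSort = StreamVal ` AS"

text \<open>
  An interpretation \<open>I\<close> is constrained only on symbols of the signature and on arguments
  from the carriers. The closure condition for \<^const>\<open>Cons\<close> makes \<open>AS\<close> closed under
  prepending bits.
\<close>

definition stream_algebra ::
  "symbol set \<Rightarrow> (nat \<Rightarrow> bool) set \<Rightarrow> (symbol \<Rightarrow> val list \<Rightarrow> val) \<Rightarrow> bool" where
  "stream_algebra \<Sigma> AS I \<longleftrightarrow>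
     AS \<noteq> {} \<and>
     (\<forall>f \<in> \<Sigma>. \<forall>vs. list_all2 (\<lambda>v s. v \<in> carrier AS s) vs (arg_sorts f) \<longrightarrow>
        I f vs \<in> carrier AS (res_sort f)) \<and>
     I Zero [] = BitVal False \<and>
     I One [] = BitVal True \<and>
     (\<forall>x. \<forall>\<sigma> \<in> AS. I Cons [BitVal x, StreamVal \<sigma>] = StreamVal (case_nat x \<sigma>))"

fun eval_trm :: "(symbol \<Rightarrow> val list \<Rightarrow> val) \<Rightarrow> (nat \<Rightarrow> srt \<Rightarrow> val) \<Rightarrow> trm \<Rightarrow> val" where
  "eval_trm I \<alpha> (Var x s) = \<alpha> x s"
| "eval_trm I \<alpha> (App f ts) = I f (map (eval_trm I \<alpha>) ts)"

definition models ::
  "(nat \<Rightarrow> bool) set \<Rightarrow> (symbol \<Rightarrow> val list \<Rightarrow> val) \<Rightarrow> (trm \<times> trm) set \<Rightarrow> bool" where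
  "models AS I E \<longleftrightarrow>
     (\<forall>\<alpha>. (\<forall>x s. \<alpha> x s \<in> carrier AS s) \<longrightarrow>
        (\<forall>(l, r) \<in> E. eval_trm I \<alpha> l = eval_trm I \<alpha> r))"

text \<open>The assignment is irrelevant below, since \<open>sol\<close> is only used for ground terms.\<close>

definition sol :: "symbol set \<Rightarrow> trm \<Rightarrow> (trm \<times> trm) set \<Rightarrow> (nat \<Rightarrow> bool) set" where
  "sol \<Sigma> t E =
     {\<sigma>. \<exists>AS I. stream_algebra \<Sigma> AS I \<and> models AS I E \<and>
           eval_trm I (\<lambda>_ _. undefined) t = StreamVal \<sigma>}"


section \<open>Coding of instances\<close>

text \<open>
  Half an instance consists of a signature, a specification and a term. To be coded as a number,
  a signature has to be finite; finite sets are given by lists of their elements.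
\<close>

type_synonym spec_term = "symbol list \<times> (trm \<times> trm) list \<times> trm"

fun valid_spec_term :: "spec_term \<Rightarrow> bool" where
  "valid_spec_term (\<Sigma>, E, t) \<longleftrightarrow>
     bitstream_signature (set \<Sigma>) \<and> bitstream_spec (set \<Sigma>) (set E) \<and>
     has_sort (set \<Sigma>) t StreamSort \<and> ground t"

fun solutions :: "spec_term \<Rightarrow> (nat \<Rightarrow> bool) set" where
  "solutions (\<Sigma>, E, t) = sol (set \<Sigma>) t (set E)"

fun code_srt :: "srt \<Rightarrow> nat" where
  "code_srt BitSort = 0"
| "code_srt StreamSort = 1"

fun code_symbol :: "symbol \<Rightarrow> nat" where
  "code_symbol Zero = list_encode [0]"
| "code_symbol One = list_encode [1]"
| "code_symbol Cons = list_encode [2]"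
| "code_symbol (Fun f ss s) = list_encode [3, f, list_encode (map code_srt ss), code_srt s]"

fun code_trm :: "trm \<Rightarrow> nat" where
  "code_trm (Var x s) = list_encode [0, x, code_srt s]"
| "code_trm (App f ts) = list_encode (1 # code_symbol f # map code_trm ts)"

fun code_equation :: "trm \<times> trm \<Rightarrow> nat" where
  "code_equation (l, r) = prod_encode (code_trm l, code_trm r)"

fun code_spec_term :: "spec_term \<Rightarrow> nat" where
  "code_spec_term (\<Sigma>, E, t) =
     list_encode [list_encode (map code_symbol \<Sigma>), list_encode (map code_equation E), code_trm t]"

fun code_instance :: "spec_term \<times> spec_term \<Rightarrow> nat" where
  "code_instance (p, q) = prod_encode (code_spec_term p, code_spec_term q)"

lemma inj_code_srt: "inj code_srt"
  by (rule injI) (metis code_srt.elims zero_neq_one)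

lemma inj_code_symbol: "inj code_symbol"
proof (rule injI)
  fix f g assume "code_symbol f = code_symbol g"
  then show "f = g"
    by (cases f; cases g)
      (auto simp del: list_encode.simps
        simp: list_encode_eq inj_code_srt[THEN inj_eq] inj_map_eq_map[OF inj_code_srt])
qed

lemma inj_code_trm: "inj code_trm"
proof (rule injI)
  fix t u show "code_trm t = code_trm u \<Longrightarrow> t = u"
  proof (induction t arbitrary: u)
    case (Var x s)
    then show ?case
      by (cases u)
        (auto simp del: list_encode.simps simp: list_encode_eq inj_code_srt[THEN inj_eq])
  next
    case (App f ts)
    then obtain us where u: "u = App f us" and eq: "map code_trm ts = map code_trm us"
      by (cases u)
        (auto simp del: list_encode.simps simp: list_encode_eq inj_code_symbol[THEN inj_eq])
    have "ts = us"
    proof (rule nth_equalityI)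
      show len: "length ts = length us" using eq by (rule map_eq_imp_length_eq)
      fix i assume i: "i < length ts"
      with eq len have "code_trm (ts ! i) = code_trm (us ! i)" by (metis nth_map)
      with i show "ts ! i = us ! i" using App.IH by simp
    qed
    with u show ?case by simp
  qed
qed

lemma inj_code_equation: "inj code_equation"
  by (rule injI) (auto simp: inj_code_trm[THEN inj_eq])

lemma inj_code_spec_term: "inj code_spec_term"
  by (rule injI)
    (auto simp del: list_encode.simps simp: list_encode_eq inj_code_trm[THEN inj_eq]
      inj_map_eq_map[OF inj_code_symbol] inj_map_eq_map[OF inj_code_equation])

lemma inj_code_instance: "inj code_instance"
  by (rule injI) (auto simp del: code_spec_term.simps simp: inj_code_spec_term[THEN inj_eq])

definition sol_equality_problem :: "nat set" where
  "sol_equality_problem =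
     {code_instance (p, q) | p q.
        valid_spec_term p \<and> valid_spec_term q \<and> solutions p = solutions q}"


section \<open>Partial recursive functions and many-one reducibility\<close>

datatype recf =
    ZeroF
  | SuccF
  | ProjF nat
  | CompF recf "recf list"
  | PrimRecF recf recf
  | MinF recf

inductive computes :: "recf \<Rightarrow> nat list \<Rightarrow> nat \<Rightarrow> bool" where
  "computes ZeroF xs 0"
| "computes SuccF [x] (Suc x)"
| "i < length xs \<Longrightarrow> computes (ProjF i) xs (xs ! i)"
| "list_all2 (\<lambda>g y. computes g xs y) gs ys \<Longrightarrow> computes f ys z \<Longrightarrow>
    computes (CompF f gs) xs z"
| "computes f xs y \<Longrightarrow> computes (PrimRecF f g) (0 # xs) y"
| "computes (PrimRecF f g) (n # xs) y \<Longrightarrow> computes g (n # y # xs) z \<Longrightarrow>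
    computes (PrimRecF f g) (Suc n # xs) z"
| "computes f (n # xs) 0 \<Longrightarrow> \<forall>m < n. \<exists>y. computes f (m # xs) (Suc y) \<Longrightarrow>
    computes (MinF f) xs n"

definition partial_recursive :: "(nat \<rightharpoonup> nat) \<Rightarrow> bool" where
  "partial_recursive f \<longleftrightarrow> (\<exists>r. \<forall>n y. f n = Some y \<longleftrightarrow> computes r [n] y)"

text \<open>
  The reducing function may be undefined at some \<open>n\<close>; an undefined \<open>f n\<close> does not
  belong to \<open>Q\<close>, hence \<open>n \<notin> P\<close> in that case.
\<close>

definition many_one_reducible :: "nat set \<Rightarrow> nat set \<Rightarrow> bool" where
  "many_one_reducible P Q \<longleftrightarrow>
     (\<exists>f. partial_recursive f \<and> (\<forall>n. n \<in> P \<longleftrightarrow> (\<exists>m. f n = Some m \<and> m \<in> Q)))"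

definition complete_for :: "nat set set \<Rightarrow> nat set \<Rightarrow> bool" where
  "complete_for \<C> P \<longleftrightarrow>
     (\<forall>Q \<in> \<C>. many_one_reducible Q P) \<and> (\<exists>Q \<in> \<C>. many_one_reducible P Q)"


section \<open>The class \<open>\<Pi>\<^sup>1\<^sub>2\<close> of the analytical hierarchy\<close>

text \<open>Arithmetical formulas with number variables and free unary function variables.\<close>

datatype nterm =
    NVar nat
  | NZero
  | NSuc nterm
  | NAdd nterm nterm
  | NMul nterm nterm
  | NApp nat nterm

datatype arith_form =
    Eq nterm nterm
  | Neg arith_form
  | Conj arith_form arith_form
  | All nat arith_form

fun eval_nterm :: "(nat \<Rightarrow> nat \<Rightarrow> nat) \<Rightarrow> (nat \<Rightarrow> nat) \<Rightarrow> nterm \<Rightarrow> nat" where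
  "eval_nterm F e (NVar x) = e x"
| "eval_nterm F e NZero = 0"
| "eval_nterm F e (NSuc a) = Suc (eval_nterm F e a)"
| "eval_nterm F e (NAdd a b) = eval_nterm F e a + eval_nterm F e b"
| "eval_nterm F e (NMul a b) = eval_nterm F e a * eval_nterm F e b"
| "eval_nterm F e (NApp i a) = F i (eval_nterm F e a)"

fun holds :: "(nat \<Rightarrow> nat \<Rightarrow> nat) \<Rightarrow> (nat \<Rightarrow> nat) \<Rightarrow> arith_form \<Rightarrow> bool" where
  "holds F e (Eq a b) \<longleftrightarrow> eval_nterm F e a = eval_nterm F e b"
| "holds F e (Neg \<phi>) \<longleftrightarrow> \<not> holds F e \<phi>"
| "holds F e (Conj \<phi> \<psi>) \<longleftrightarrow> holds F e \<phi> \<and> holds F e \<psi>"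
| "holds F e (All x \<phi>) \<longleftrightarrow> (\<forall>n. holds F (e(x := n)) \<phi>)"

text \<open>
  Number variable 0 is the element under consideration and function variables 0 and 1 carry the
  quantifier prefix; all other free variables are fixed to zero, so no parameters are admitted.
\<close>

definition Pi12 :: "nat set set" where
  "Pi12 = {P. \<exists>\<phi>. P =
     {n. \<forall>f. \<exists>g. holds ((\<lambda>_ _. 0)(0 := f, 1 := g)) ((\<lambda>_. 0)(0 := n)) \<phi>}}"

end

(* Upper bound: by the downward Loewenheim-Skolem theorem a stream is a solution iff it is the value
   of the term in a model with countable carrier, and such a model together with the evaluation of
   terms is coded by a function on the natural numbers subject to an arithmetical condition. Hence
   solution sets are Sigma^1_1, and their equality is Pi^1_2. All recursive auxiliary functions are
   existentially quantified along with the model, which avoids arithmetizing recursion.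

   Lower bound: since the carrier of bits is fixed, equality of streams, Boolean connectives and
   conditionals are definable by equations, and Skolem functions turn first-order sentences into
   equations. The standard natural numbers are singled out among the streams because positions in
   streams are standard. For an arithmetical formula phi(f, g, n), this yields a specification of a
   constant whose solutions are the streams s such that phi(f, g, n) holds for some g and some f
   compatible with the relation represented by s. All streams are solutions iff for every f there is
   a g with phi(f, g, n), and a constant without equations has all streams as solutions. *)

theory Submission
  imports Defs "HOL-Library.Countable_Set"
begin

text \<open>Membership: equality of two solution sets amounts to two implications between Sigma^1_1
  statements. The universal function carries a stream and one candidate model for each side, the
  existential function the answering models, so both implications share a single forall-exists
  prefix; an answer is required only if the candidate really is a model. Hardness: every function
  has to be carried by some stream, but most streams are not graphs of functions. The last base
  equation asks of \<open>uniF\<close> only that it choose from each nonempty fibre of the relation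
  given by \<open>argF\<close>. On the graph of a function this determines \<open>uniF\<close> at
  all numbers, and every stream admits some choice function, so streams that are no graphs create no
  exceptions. The obstacle is that equations speak of all streams but arithmetic only of numbers. In
  an arbitrary model nothing is known in advance about truth values at other streams; in the model
  to be constructed, addition, multiplication and truth have to be extended to them.\<close>

section \<open>Arithmetical formulas over coded functions\<close>

text \<open>Unlike \<^const>\<open>prod_encode\<close>, this injective pairing is given by a term of arithmetic.\<close>

definition pp :: "nat \<Rightarrow> nat \<Rightarrow> nat" where
  "pp m n = (m + n) * (m + n) + m"

text \<open>\<open>pp m n\<close> lies between the square of \<open>m + n\<close> and the next
  square. Hence its value determines the sum first, and then \<open>m\<close> as the
  remainder.\<close>

lemma pp_eq_iff [simp]: "pp m n = pp m' n' \<longleftrightarrow> m = m' \<and> n = n'"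
proof
  assume eq: "pp m n = pp m' n'"
  have less: "pp a b < pp c d" if "a + b < c + d" for a b c d
  proof -
    have "pp a b < Suc (a + b) * Suc (a + b)" by (simp add: pp_def)
    also have "\<dots> \<le> (c + d) * (c + d)" using that by (intro mult_mono) auto
    also have "\<dots> \<le> pp c d" by (simp add: pp_def)
    finally show ?thesis .
  qed
  have "m + n = m' + n'" using less[of m n m' n'] less[of m' n' m n] eq by linarith
  with eq show "m = m' \<and> n = n'" by (simp add: pp_def)
qed simp

text \<open>Block \<open>j\<close> of a single function variable \<open>G\<close> holds a family of binary functions.\<close>

definition blk :: "(nat \<Rightarrow> nat) \<Rightarrow> nat \<Rightarrow> nat \<Rightarrow> nat \<Rightarrow> nat \<Rightarrow> nat" where
  "blk G j k x y = G (pp j (pp k (pp x y)))"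

text \<open>\<open>pp\<close> is not onto, but only the values of \<open>G\<close> at codes are
  prescribed, so injectivity is enough. This lets any finite collection of witnesses be packed into
  one function variable.\<close>

lemma ex_blk: "\<exists>G. blk G = H"
proof -
  let ?c = "\<lambda>(j, k, x, y). pp j (pp k (pp x y))"
  have inj: "inj ?c" by (auto simp: inj_def)
  have "blk (\<lambda>n. (\<lambda>(j, k, x, y). H j k x y) (inv ?c n)) j k x y = H j k x y" for j k x y
    using inv_f_f[OF inj, of "(j, k, x, y)"] by (simp add: blk_def)
  then show ?thesis by blast
qed

fun Num :: "nat \<Rightarrow> nterm" where
  "Num 0 = NZero"
| "Num (Suc n) = NSuc (Num n)"

definition PP :: "nterm \<Rightarrow> nterm \<Rightarrow> nterm" where
  "PP a b = NAdd (NMul (NAdd a b) (NAdd a b)) a"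

definition Blk :: "nat \<Rightarrow> nat \<Rightarrow> nat \<Rightarrow> nterm \<Rightarrow> nterm \<Rightarrow> nterm" where
  "Blk i j k a b = NApp i (PP (Num j) (PP (Num k) (PP a b)))"

definition Imp :: "arith_form \<Rightarrow> arith_form \<Rightarrow> arith_form" where
  "Imp \<phi> \<psi> = Neg (Conj \<phi> (Neg \<psi>))"

definition Disj :: "arith_form \<Rightarrow> arith_form \<Rightarrow> arith_form" where
  "Disj \<phi> \<psi> = Neg (Conj (Neg \<phi>) (Neg \<psi>))"

definition Exist :: "nat \<Rightarrow> arith_form \<Rightarrow> arith_form" where
  "Exist x \<phi> = Neg (All x (Neg \<phi>))"

fun Conjs :: "arith_form list \<Rightarrow> arith_form" where
  "Conjs [] = Eq NZero NZero"
| "Conjs [\<phi>] = \<phi>"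
| "Conjs (\<phi> # \<phi>s) = Conj \<phi> (Conjs \<phi>s)"

fun Alls :: "nat list \<Rightarrow> arith_form \<Rightarrow> arith_form" where
  "Alls [] \<phi> = \<phi>"
| "Alls (x # xs) \<phi> = All x (Alls xs \<phi>)"

fun Exs :: "nat list \<Rightarrow> arith_form \<Rightarrow> arith_form" where
  "Exs [] \<phi> = \<phi>"
| "Exs (x # xs) \<phi> = Exist x (Exs xs \<phi>)"

lemma eval_Num [simp]: "eval_nterm F e (Num n) = n"
  by (induction n) auto

lemma eval_PP [simp]: "eval_nterm F e (PP a b) = pp (eval_nterm F e a) (eval_nterm F e b)"
  by (simp add: PP_def pp_def)

lemma eval_Blk [simp]:
  "eval_nterm F e (Blk i j k a b) = blk (F i) j k (eval_nterm F e a) (eval_nterm F e b)"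
  by (simp add: Blk_def blk_def)

lemma holds_Imp [simp]: "holds F e (Imp \<phi> \<psi>) \<longleftrightarrow> (holds F e \<phi> \<longrightarrow> holds F e \<psi>)"
  by (simp add: Imp_def)

lemma holds_Disj [simp]: "holds F e (Disj \<phi> \<psi>) \<longleftrightarrow> holds F e \<phi> \<or> holds F e \<psi>"
  by (auto simp: Disj_def)

lemma holds_Ex [simp]: "holds F e (Exist x \<phi>) \<longleftrightarrow> (\<exists>n. holds F (e(x := n)) \<phi>)"
  by (simp add: Exist_def)

section \<open>Codes of terms and their sorts\<close>

text \<open>This is the recursion of \<open>list_encode\<close> with \<open>H 0\<close> in place of
  \<open>prod_encode\<close>; \<open>Seq\<close> is its counterpart on terms of arithmetic.\<close>

definition seq :: "(nat \<Rightarrow> nat \<Rightarrow> nat \<Rightarrow> nat) \<Rightarrow> nat list \<Rightarrow> nat" where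
  "seq H xs = foldr (\<lambda>x l. Suc (H 0 x l)) xs 0"

definition Seq :: "(nat \<Rightarrow> nterm \<Rightarrow> nterm \<Rightarrow> nterm) \<Rightarrow> nterm list \<Rightarrow> nterm" where
  "Seq h ts = foldr (\<lambda>x l. NSuc (h 0 x l)) ts NZero"

text \<open>The first clause is the triangular-number formula for \<open>prod_encode\<close>,
  doubled to avoid a division. The other clauses define membership by recursion along the
  list.\<close>

definition list_coding :: "(nat \<Rightarrow> nat \<Rightarrow> nat \<Rightarrow> nat) \<Rightarrow> bool" where
  "list_coding H \<longleftrightarrow>
     (\<forall>x y. H 0 x y + H 0 x y = (x + y) * Suc (x + y) + (x + x)) \<and>
     (\<forall>x. H 1 x 0 = 0) \<and>
     (\<forall>x y l. (x = y \<longrightarrow> H 1 x (Suc (H 0 y l)) = 1) \<and>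
              (x \<noteq> y \<longrightarrow> H 1 x (Suc (H 0 y l)) = H 1 x l))"

definition list_coding_form :: "(nat \<Rightarrow> nterm \<Rightarrow> nterm \<Rightarrow> nterm) \<Rightarrow> arith_form" where
  "list_coding_form h =
    (let x = NVar 10; y = NVar 11; l = NVar 12 in Conjs [
      Alls [10, 11] (Eq (NAdd (h 0 x y) (h 0 x y)) (NAdd (NMul (NAdd x y) (NSuc (NAdd x y))) (NAdd x x))),
      Alls [10] (Eq (h 1 x NZero) NZero),
      Alls [10, 11, 12] (Conj
        (Imp (Eq x y) (Eq (h 1 x (NSuc (h 0 y l))) (Num 1)))
        (Imp (Neg (Eq x y)) (Eq (h 1 x (NSuc (h 0 y l))) (h 1 x l))))])"

lemma holds_list_coding_form [simp]:
  "holds F e (list_coding_form (Blk i j)) \<longleftrightarrow> list_coding (blk (F i) j)"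
  by (simp add: list_coding_form_def list_coding_def Let_def)

text \<open>
  \<open>H 0\<close> is the pairing function, \<open>H 1 x l = 1\<close> means that \<open>x\<close> is a member of the list \<open>l\<close>,
  \<open>H 2\<close> recognizes lists of sorts, and \<open>H 3 (pp v c) s = 1\<close> and \<open>H 4 (pp v ts) ss = 1\<close> mean
  that the term \<open>c\<close> or list of terms \<open>ts\<close> has the given sorts, where variables may occur if
  \<open>v = 1\<close>. For \<open>H 2\<close>, \<open>H 3\<close> and \<open>H 4\<close> it suffices to demand implications that unfold the
  inductive definition once: codes of subterms are smaller, so these implications already put the
  coded relations below the intended ones.
\<close>

definition validity :: "(nat \<Rightarrow> nat \<Rightarrow> nat \<Rightarrow> nat) \<Rightarrow> nat \<Rightarrow> bool" where
  "validity H p \<longleftrightarrow> list_coding H \<and> (\<exists>S E t. p = seq H [S, E, t] \<and>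
     H 1 (seq H [0]) S = 1 \<and> H 1 (seq H [1]) S = 1 \<and> H 1 (seq H [2]) S = 1 \<and>
     (\<forall>f. H 1 f S = 1 \<longrightarrow> f = seq H [0] \<or> f = seq H [1] \<or> f = seq H [2] \<or>
        (\<exists>i ss s. f = seq H [3, i, ss, s] \<and> (s = 0 \<or> s = 1) \<and> H 2 ss 0 = 1)) \<and>
     (\<forall>ss. H 2 ss 0 = 1 \<longrightarrow>
        ss = 0 \<or> (\<exists>s r. ss = Suc (H 0 s r) \<and> (s = 0 \<or> s = 1) \<and> H 2 r 0 = 1)) \<and>
     (\<forall>eq. H 1 eq E = 1 \<longrightarrow>
        (\<exists>l r s. eq = H 0 l r \<and> H 3 (pp 1 l) s = 1 \<and> H 3 (pp 1 r) s = 1)) \<and>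
     H 3 (pp 0 t) 1 = 1 \<and>
     (\<forall>v c s. H 3 (pp v c) s = 1 \<longrightarrow>
        v = 1 \<and> (s = 0 \<or> s = 1) \<and> (\<exists>x. c = seq H [0, x, s]) \<or>
        (\<exists>f ts ss. c = Suc (H 0 1 (Suc (H 0 f ts))) \<and> H 1 f S = 1 \<and> H 4 (pp v ts) ss = 1 \<and>
           (f = seq H [0] \<and> ss = 0 \<and> s = 0 \<or> f = seq H [1] \<and> ss = 0 \<and> s = 0 \<or>
            f = seq H [2] \<and> ss = seq H [0, 1] \<and> s = 1 \<or> (\<exists>i. f = seq H [3, i, ss, s])))) \<and>
     (\<forall>v ts ss. H 4 (pp v ts) ss = 1 \<longrightarrow> ts = 0 \<and> ss = 0 \<or>
        (\<exists>c l s r. ts = Suc (H 0 c l) \<and> ss = Suc (H 0 s r) \<and>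
           H 3 (pp v c) s = 1 \<and> H 4 (pp v l) r = 1)))"

definition validity_form :: "(nat \<Rightarrow> nterm \<Rightarrow> nterm \<Rightarrow> nterm) \<Rightarrow> nterm \<Rightarrow> arith_form" where
  "validity_form h p =
    (let S = NVar 3; E = NVar 4; t = NVar 5;
         isone = (\<lambda>a. Eq a (Num 1));
         bit = (\<lambda>s. Disj (Eq s NZero) (Eq s (Num 1)));
         sq = Seq h in
     Conj (list_coding_form h) (Exs [3, 4, 5] (Conjs [
      Eq p (sq [S, E, t]),
      isone (h 1 (sq [Num 0]) S), isone (h 1 (sq [Num 1]) S), isone (h 1 (sq [Num 2]) S),
      (let f = NVar 10; i = NVar 11; ss = NVar 12; s = NVar 13 in
       All 10 (Imp (isone (h 1 f S)) (Disj (Eq f (sq [Num 0])) (Disj (Eq f (sq [Num 1]))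
         (Disj (Eq f (sq [Num 2])) (Exs [11, 12, 13]
            (Conjs [Eq f (sq [Num 3, i, ss, s]), bit s, isone (h 2 ss NZero)]))))))),
      (let s = NVar 11; r = NVar 12; ss = NVar 10 in
       All 10 (Imp (isone (h 2 ss NZero)) (Disj (Eq ss NZero)
         (Exs [11, 12] (Conjs [Eq ss (NSuc (h 0 s r)), bit s, isone (h 2 r NZero)]))))),
      (let eq = NVar 10; l = NVar 11; r = NVar 12; s = NVar 13 in
       All 10 (Imp (isone (h 1 eq E)) (Exs [11, 12, 13] (Conjs [Eq eq (h 0 l r),
         isone (h 3 (PP (Num 1) l) s), isone (h 3 (PP (Num 1) r) s)])))),
      isone (h 3 (PP NZero t) (Num 1)),
      (let v = NVar 10; c = NVar 11; s = NVar 12; f = NVar 13; ts = NVar 14; ss = NVar 15; x = NVar 16 in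
       Alls [10, 11, 12] (Imp (isone (h 3 (PP v c) s)) (Disj
         (Conjs [isone v, bit s, Exist 16 (Eq c (sq [Num 0, x, s]))])
         (Exs [13, 14, 15] (Conjs [Eq c (NSuc (h 0 (Num 1) (NSuc (h 0 f ts)))), isone (h 1 f S),
           isone (h 4 (PP v ts) ss),
           Disj (Conjs [Eq f (sq [Num 0]), Eq ss NZero, Eq s NZero])
           (Disj (Conjs [Eq f (sq [Num 1]), Eq ss NZero, Eq s NZero])
           (Disj (Conjs [Eq f (sq [Num 2]), Eq ss (sq [Num 0, Num 1]), isone s])
              (Exist 16 (Eq f (sq [Num 3, x, ss, s])))))]))))),
      (let v = NVar 10; ts = NVar 11; ss = NVar 12; c = NVar 13; l = NVar 14; s = NVar 15; r = NVar 16 in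
       Alls [10, 11, 12] (Imp (isone (h 4 (PP v ts) ss)) (Disj (Conj (Eq ts NZero) (Eq ss NZero))
         (Exs [13, 14, 15, 16] (Conjs [Eq ts (NSuc (h 0 c l)), Eq ss (NSuc (h 0 s r)),
           isone (h 3 (PP v c) s), isone (h 4 (PP v l) r)])))))])))"

text \<open>Number variables 0 to 2 hold the instance and its two halves, 3 to 5 the components of a
  half, and those from 10 on are bound by the inner quantifiers; \<open>x < 3\<close> thus rules out
  capture.\<close>

lemma holds_validity_form [simp]:
  assumes "x < 3"
  shows "holds F e (validity_form (Blk i j) (NVar x)) \<longleftrightarrow> validity (blk (F i) j) (e x)"
  using assms
  by (simp add: validity_form_def validity_def Let_def seq_def Seq_def del: Num.simps One_nat_def)

text \<open>
  \<open>H 2 a i\<close> is entry \<open>i\<close> of the list \<open>a\<close> that codes an assignment (entry \<open>2x\<close> for the bit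
  variable \<open>x\<close>, entry \<open>2x + 1\<close> for the stream variable \<open>x\<close>), \<open>H 3 i\<close> is the \<open>i\<close>-th element of
  the carrier, \<open>H 4\<close> interprets symbols, and \<open>H 5 a\<close> and \<open>H 6 a\<close> evaluate terms and lists of
  terms. Streams are represented by their index, and the enumeration of the carrier is injective so
  that equal values have equal codes.
\<close>

definition coded_model :: "(nat \<Rightarrow> nat \<Rightarrow> nat \<Rightarrow> nat) \<Rightarrow> nat \<Rightarrow> (nat \<Rightarrow> nat) \<Rightarrow> bool" where
  "coded_model H p \<sigma> \<longleftrightarrow> list_coding H \<and> (\<exists>S E t. p = seq H [S, E, t] \<and>
     (\<forall>x l. H 2 (Suc (H 0 x l)) 0 = x) \<and>
     (\<forall>x l i. H 2 (Suc (H 0 x l)) (Suc i) = H 2 l i) \<and>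
     (\<forall>i k. H 3 i k = 0 \<or> H 3 i k = 1) \<and>
     (\<forall>i j. (\<forall>k. H 3 i k = H 3 j k) \<longrightarrow> i = j) \<and>
     H 4 (seq H [0]) 0 = 0 \<and>
     H 4 (seq H [1]) 0 = 1 \<and>
     (\<forall>b i. b = 0 \<or> b = 1 \<longrightarrow> H 3 (H 4 (seq H [2]) (seq H [b, i])) 0 = b) \<and>
     (\<forall>b i k. b = 0 \<or> b = 1 \<longrightarrow> H 3 (H 4 (seq H [2]) (seq H [b, i])) (Suc k) = H 3 i k) \<and>
     (\<forall>f ss v. H 4 (seq H [3, f, ss, 0]) v = 0 \<or> H 4 (seq H [3, f, ss, 0]) v = 1) \<and>
     (\<forall>a x. H 2 a (x + x) = 0 \<longrightarrow> H 5 a (seq H [0, x, 0]) = 0) \<and>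
     (\<forall>a x. H 2 a (x + x) \<noteq> 0 \<longrightarrow> H 5 a (seq H [0, x, 0]) = 1) \<and>
     (\<forall>a x. H 5 a (seq H [0, x, 1]) = H 2 a (Suc (x + x))) \<and>
     (\<forall>a f ts. H 5 a (Suc (H 0 1 (Suc (H 0 f ts)))) = H 4 f (H 6 a ts)) \<and>
     (\<forall>a. H 6 a 0 = 0) \<and>
     (\<forall>a c l. H 6 a (Suc (H 0 c l)) = Suc (H 0 (H 5 a c) (H 6 a l))) \<and>
     (\<forall>l r. H 1 (H 0 l r) E = 1 \<longrightarrow> (\<forall>a. H 5 a l = H 5 a r)) \<and>
     (\<forall>k. H 3 (H 5 0 t) k = 0 \<longleftrightarrow> \<sigma> k = 0))"

definition coded_model_form ::
  "(nat \<Rightarrow> nterm \<Rightarrow> nterm \<Rightarrow> nterm) \<Rightarrow> nterm \<Rightarrow> (nterm \<Rightarrow> nterm) \<Rightarrow> arith_form" where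
  "coded_model_form h p \<sigma> =
    (let S = NVar 3; E = NVar 4; t = NVar 5; x = NVar 10; y = NVar 11; z = NVar 12;
         isone = (\<lambda>a. Eq a (Num 1));
         bit = (\<lambda>s. Disj (Eq s NZero) (Eq s (Num 1)));
         sq = Seq h in
     Conj (list_coding_form h) (Exs [3, 4, 5] (Conjs [
      Eq p (sq [S, E, t]),
      Alls [10, 11] (Eq (h 2 (NSuc (h 0 x y)) NZero) x),
      Alls [10, 11, 12] (Eq (h 2 (NSuc (h 0 x y)) (NSuc z)) (h 2 y z)),
      Alls [10, 11] (bit (h 3 x y)),
      Alls [10, 11] (Imp (All 12 (Eq (h 3 x z) (h 3 y z))) (Eq x y)),
      Eq (h 4 (sq [Num 0]) NZero) NZero,
      isone (h 4 (sq [Num 1]) NZero),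
      Alls [10, 11] (Imp (bit x) (Eq (h 3 (h 4 (sq [Num 2]) (sq [x, y])) NZero) x)),
      Alls [10, 11, 12]
        (Imp (bit x) (Eq (h 3 (h 4 (sq [Num 2]) (sq [x, y])) (NSuc z)) (h 3 y z))),
      Alls [10, 11, 12] (bit (h 4 (sq [Num 3, x, y, NZero]) z)),
      Alls [10, 11] (Imp (Eq (h 2 x (NAdd y y)) NZero) (Eq (h 5 x (sq [Num 0, y, Num 0])) NZero)),
      Alls [10, 11] (Imp (Neg (Eq (h 2 x (NAdd y y)) NZero)) (isone (h 5 x (sq [Num 0, y, Num 0])))),
      Alls [10, 11] (Eq (h 5 x (sq [Num 0, y, Num 1])) (h 2 x (NSuc (NAdd y y)))),
      Alls [10, 11, 12] (Eq (h 5 x (NSuc (h 0 (Num 1) (NSuc (h 0 y z))))) (h 4 y (h 6 x z))),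
      All 10 (Eq (h 6 x NZero) NZero),
      Alls [10, 11, 12] (Eq (h 6 x (NSuc (h 0 y z))) (NSuc (h 0 (h 5 x y) (h 6 x z)))),
      Alls [10, 11] (Imp (isone (h 1 (h 0 x y) E)) (All 12 (Eq (h 5 z x) (h 5 z y)))),
      All 10 (Conj (Imp (Eq (h 3 (h 5 NZero t) x) NZero) (Eq (\<sigma> x) NZero))
        (Imp (Eq (\<sigma> x) NZero) (Eq (h 3 (h 5 NZero t) x) NZero)))])))"

lemma holds_coded_model_form [simp]:
  assumes "x < 3"
  shows "holds F e (coded_model_form (Blk i j) (NVar x) (\<lambda>k. Blk i' j' 0 k NZero)) \<longleftrightarrow>
    coded_model (blk (F i) j) (e x) (\<lambda>k. blk (F i') j' 0 k 0)"
  using assms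
  by (simp add: coded_model_form_def coded_model_def Let_def seq_def Seq_def iff_conv_conj_imp
      del: Num.simps One_nat_def)

text \<open>In function variable 0, blocks 0 and 1 hold candidate models of the first and second
  specification, and block 2 the stream. In function variable 1, blocks 0 and 1 hold the answering
  models of the opposite specification, and blocks 2 and 3 the witnesses of validity. The pairing
  that joins the two halves is borrowed from block 2.\<close>

definition sol_equality_form :: arith_form where
  "sol_equality_form = Exs [1, 2] (Conjs [
     validity_form (Blk 1 2) (NVar 1), validity_form (Blk 1 3) (NVar 2),
     Eq (NVar 0) (Blk 1 2 0 (NVar 1) (NVar 2)),
     Imp (coded_model_form (Blk 0 0) (NVar 1) (\<lambda>k. Blk 0 2 0 k NZero))
       (coded_model_form (Blk 1 0) (NVar 2) (\<lambda>k. Blk 0 2 0 k NZero)),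
     Imp (coded_model_form (Blk 0 1) (NVar 2) (\<lambda>k. Blk 0 2 0 k NZero))
       (coded_model_form (Blk 1 1) (NVar 1) (\<lambda>k. Blk 0 2 0 k NZero))])"

lemma holds_sol_equality_form:
  "holds ((\<lambda>_ _. 0)(0 := f, 1 := g)) ((\<lambda>_. 0)(0 := n)) sol_equality_form \<longleftrightarrow>
   (\<exists>p q. validity (blk g 2) p \<and> validity (blk g 3) q \<and> n = blk g 2 0 p q \<and>
     (coded_model (blk f 0) p (\<lambda>k. blk f 2 0 k 0) \<longrightarrow> coded_model (blk g 0) q (\<lambda>k. blk f 2 0 k 0)) \<and>
     (coded_model (blk f 1) q (\<lambda>k. blk f 2 0 k 0) \<longrightarrow> coded_model (blk g 1) p (\<lambda>k. blk f 2 0 k 0)))"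
  by (simp add: sol_equality_form_def)

section \<open>Correctness of the coding of valid specifications\<close>

definition mem_code :: "nat \<Rightarrow> nat \<Rightarrow> nat" where
  "mem_code x l = of_bool (x \<in> set (list_decode l))"

lemma prod_encode_double:
  "prod_encode (x, y) + prod_encode (x, y) = (x + y) * Suc (x + y) + (x + x)"
proof -
  have "triangle n + triangle n = n * Suc n" for n
    by (induction n) auto
  from this[of "x + y"] show ?thesis by (simp add: prod_encode_def)
qed

text \<open>Every number is a pair code and a list code, so the clauses leave no freedom. In
  particular all blocks that satisfy them agree on the coding.\<close>

lemma list_coding_iff:
  "list_coding H \<longleftrightarrow> H 0 = (\<lambda>x y. prod_encode (x, y)) \<and> H 1 = mem_code"
proof
  assume H: "list_coding H"
  have pair: "H 0 x y = prod_encode (x, y)" for x y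
  proof -
    have "H 0 x y + H 0 x y = prod_encode (x, y) + prod_encode (x, y)"
      using H unfolding list_coding_def prod_encode_double by blast
    then show ?thesis by linarith
  qed
  have nil: "H 1 x 0 = 0" for x
    using H unfolding list_coding_def by blast
  have cons: "H 1 x (Suc (H 0 y l)) = (if x = y then 1 else H 1 x l)" for x y l
    using H unfolding list_coding_def by (cases "x = y") presburger+
  have "H 1 x (list_encode xs) = mem_code x (list_encode xs)" for x xs
    by (induction xs) (use nil cons in \<open>simp_all add: pair mem_code_def\<close>)
  then have "H 1 x l = mem_code x l" for x l
    by (metis list_decode_inverse)
  with pair show "H 0 = (\<lambda>x y. prod_encode (x, y)) \<and> H 1 = mem_code" by blast
next
  assume H: "H 0 = (\<lambda>x y. prod_encode (x, y)) \<and> H 1 = mem_code"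
  then have pair: "H 0 x y = prod_encode (x, y)" and mem: "H 1 x l = mem_code x l" for x y l
    by simp_all
  show "list_coding H"
    unfolding list_coding_def pair mem prod_encode_double by (simp add: mem_code_def)
qed

lemma
  assumes "list_coding H"
  shows list_coding_pair: "H 0 x y = prod_encode (x, y)"
    and list_coding_mem: "H 1 x l = mem_code x l"
    and list_coding_seq: "seq H xs = list_encode xs"
proof -
  have pair: "H 0 x y = prod_encode (x, y)" for x y
    using assms by (simp add: list_coding_iff)
  then show "H 0 x y = prod_encode (x, y)" .
  show "H 1 x l = mem_code x l"
    using assms by (simp add: list_coding_iff)
  show "seq H xs = list_encode xs"
    by (induction xs) (simp_all add: seq_def pair)
qed

lemma mem_code_eq_1 [simp]: "mem_code x (list_encode xs) = 1 \<longleftrightarrow> x \<in> set xs"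
  by (simp add: mem_code_def)

lemma code_srt_cases: "s = 0 \<or> s = 1 \<longleftrightarrow> s \<in> range code_srt"
proof
  show "s = 0 \<or> s = 1 \<Longrightarrow> s \<in> range code_srt"
    by (metis code_srt.simps rangeI)
  show "s \<in> range code_srt \<Longrightarrow> s = 0 \<or> s = 1"
    by (metis code_srt.simps imageE srt.exhaust)
qed

lemma lists_range_iff: "(\<forall>x \<in> set xs. x \<in> range f) \<longleftrightarrow> (\<exists>ys. xs = map f ys)"
  unfolding ex_map_conv by auto

text \<open>Justifies recursion from the code of a term to the codes of its arguments, in
  \<open>validity_sound\<close> and in the termination of \<open>eval_code\<close>.\<close>

lemma set_list_decode_less: "x \<in> set (list_decode n) \<Longrightarrow> x < n"
proof -
  have "x \<in> set xs \<Longrightarrow> x < list_encode xs" for xs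
  proof (induction xs)
    case (Cons y xs)
    then show ?case
      using le_prod_encode_1[of y "list_encode xs"] le_prod_encode_2[of "list_encode xs" y] by auto
  qed simp
  from this[of "list_decode n"] show "x \<in> set (list_decode n) \<Longrightarrow> x < n" by simp
qed

lemma code_trm_App: "code_trm (App f ts) =
  Suc (prod_encode (1, Suc (prod_encode (code_symbol f, list_encode (map code_trm ts)))))"
  by simp

lemma has_sort_Var_iff [simp]: "has_sort \<Sigma> (Var x s) s' \<longleftrightarrow> s' = s"
  by (auto elim: has_sort.cases intro: has_sort.intros)

lemma has_sort_App_iff [simp]: "has_sort \<Sigma> (App f ts) s \<longleftrightarrow>
   f \<in> \<Sigma> \<and> list_all2 (has_sort \<Sigma>) ts (arg_sorts f) \<and> s = res_sort f"
  by (auto elim: has_sort.cases intro: has_sort.intros)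

lemma symbol_type_code:
  "f = list_encode [0] \<and> ss = 0 \<and> s = 0 \<or> f = list_encode [1] \<and> ss = 0 \<and> s = 0 \<or>
   f = list_encode [2] \<and> ss = list_encode [0, 1] \<and> s = 1 \<or> (\<exists>i. f = list_encode [3, i, ss, s])"
  if "f = code_symbol g" "ss = list_encode (map code_srt (arg_sorts g))" "s = code_srt (res_sort g)"
  using that by (cases g) (auto simp del: list_encode.simps(2) One_nat_def)

lemma symbol_type_codeD:
  assumes "f = list_encode [0] \<and> ss = 0 \<and> s = 0 \<or> f = list_encode [1] \<and> ss = 0 \<and> s = 0 \<or>
   f = list_encode [2] \<and> ss = list_encode [0, 1] \<and> s = 1 \<or> (\<exists>i. f = list_encode [3, i, ss, s])"
   and "f = code_symbol g"
  shows "ss = list_encode (map code_srt (arg_sorts g))" "s = code_srt (res_sort g)"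
proof -
  show "ss = list_encode (map code_srt (arg_sorts g))"
    using assms
    by (cases g; elim disjE)
      (simp_all add: list_encode_eq del: list_encode.simps(2) One_nat_def)
  show "s = code_srt (res_sort g)"
    using assms
    by (cases g; elim disjE)
      (simp_all add: list_encode_eq del: list_encode.simps(2) One_nat_def)
qed

lemma validity_sound:
  assumes V: "validity H n"
  shows "\<exists>p. valid_spec_term p \<and> n = code_spec_term p"
proof -
  have H: "list_coding H" using V by (simp add: validity_def)
  note V' = V[unfolded validity_def list_coding_pair[OF H] list_coding_mem[OF H] list_coding_seq[OF H]
     code_srt_cases]
  obtain S E t where n: "n = list_encode [S, E, t]"
    and base: "mem_code (list_encode [0]) S = 1" "mem_code (list_encode [1]) S = 1"
      "mem_code (list_encode [2]) S = 1"
    and sym: "\<forall>f. mem_code f S = 1 \<longrightarrow> f = list_encode [0] \<or> f = list_encode [1] \<or>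
      f = list_encode [2] \<or> (\<exists>i ss s. f = list_encode [3, i, ss, s] \<and> s \<in> range code_srt \<and> H 2 ss 0 = 1)"
    and srts: "\<forall>ss. H 2 ss 0 = 1 \<longrightarrow>
        ss = 0 \<or> (\<exists>s r. ss = Suc (prod_encode (s, r)) \<and> s \<in> range code_srt \<and> H 2 r 0 = 1)"
    and eqs: "\<forall>eq. mem_code eq E = 1 \<longrightarrow> (\<exists>l r s. eq = prod_encode (l, r) \<and>
        H 3 (pp 1 l) s = 1 \<and> H 3 (pp 1 r) s = 1)"
    and t: "H 3 (pp 0 t) 1 = 1"
    and trm: "\<forall>v c s. H 3 (pp v c) s = 1 \<longrightarrow>
        v = 1 \<and> s \<in> range code_srt \<and> (\<exists>x. c = list_encode [0, x, s]) \<or>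
        (\<exists>f ts ss. c = Suc (prod_encode (1, Suc (prod_encode (f, ts)))) \<and> mem_code f S = 1 \<and>
           H 4 (pp v ts) ss = 1 \<and>
           (f = list_encode [0] \<and> ss = 0 \<and> s = 0 \<or> f = list_encode [1] \<and> ss = 0 \<and> s = 0 \<or>
            f = list_encode [2] \<and> ss = list_encode [0, 1] \<and> s = 1 \<or>
            (\<exists>i. f = list_encode [3, i, ss, s])))"
    and trms: "\<forall>v ts ss. H 4 (pp v ts) ss = 1 \<longrightarrow> ts = 0 \<and> ss = 0 \<or>
        (\<exists>c l s r. ts = Suc (prod_encode (c, l)) \<and> ss = Suc (prod_encode (s, r)) \<and>
           H 3 (pp v c) s = 1 \<and> H 4 (pp v l) r = 1)"
    using V' by (elim conjE exE) blast
  have srts': "\<exists>us. ss = list_encode (map code_srt us)" if "H 2 ss 0 = 1" for ss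
  proof -
    have "H 2 (list_encode xs) 0 = 1 \<Longrightarrow> set xs \<subseteq> range code_srt" for xs
    proof (induction xs)
      case (Cons x xs)
      with srts[rule_format, OF Cons.prems] show ?case by auto
    qed simp
    from this[of "list_decode ss"] that show ?thesis
      by (metis list_decode_inverse lists_range_iff subsetD)
  qed
  have "\<forall>f \<in> set (list_decode S). f \<in> range code_symbol"
  proof
    fix f assume "f \<in> set (list_decode S)"
    then have "mem_code f S = 1" by (simp add: mem_code_def)
    from sym[rule_format, OF this] show "f \<in> range code_symbol"
    proof (elim disjE exE conjE)
      fix i ss s
      assume f: "f = list_encode [3, i, ss, s]" and s: "s \<in> range code_srt" and ss: "H 2 ss 0 = 1"
      then obtain us u where "ss = list_encode (map code_srt us)" "s = code_srt u"
        using srts'[OF ss] by blast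
      with f have "f = code_symbol (Fun i us u)" by (simp only: code_symbol.simps)
      then show ?thesis by blast
    qed (metis code_symbol.simps rangeI)+
  qed
  then obtain \<Sigma> where "list_decode S = map code_symbol \<Sigma>"
    unfolding lists_range_iff by blast
  then have S: "S = list_encode (map code_symbol \<Sigma>)" by (metis list_decode_inverse)
  have memS: "mem_code (code_symbol f) S = 1 \<longleftrightarrow> f \<in> set \<Sigma>" for f
    unfolding S mem_code_eq_1 by (simp add: inj_image_mem_iff[OF inj_code_symbol])
  have trm': "H 3 (pp v c) s = 1 \<Longrightarrow> \<exists>u w. c = code_trm u \<and> s = code_srt w \<and>
      has_sort (set \<Sigma>) u w \<and> (v = 0 \<longrightarrow> ground u)" for v c s
  proof (induction c arbitrary: s rule: less_induct)
    case (less c)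
    from trm[rule_format, OF less.prems] show ?case
    proof (elim disjE[where Q = "\<exists>f. _ f"] exE conjE)
      fix x assume "v = 1" "s \<in> range code_srt" "c = list_encode [0, x, s]"
      then obtain w where "s = code_srt w" "c = code_trm (Var x w)" by auto
      with \<open>v = 1\<close> show ?thesis by (intro exI[of _ "Var x w"] exI[of _ w]) simp
    next
      fix f ts ss
      assume c: "c = Suc (prod_encode (1, Suc (prod_encode (f, ts))))"
        and f: "mem_code f S = 1" and ts: "H 4 (pp v ts) ss = 1"
        and ty: "f = list_encode [0] \<and> ss = 0 \<and> s = 0 \<or> f = list_encode [1] \<and> ss = 0 \<and> s = 0 \<or>
            f = list_encode [2] \<and> ss = list_encode [0, 1] \<and> s = 1 \<or>
            (\<exists>i. f = list_encode [3, i, ss, s])"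
      obtain g where g: "g \<in> set \<Sigma>" "f = code_symbol g"
        using f unfolding S mem_code_eq_1 by auto
      have ts_less: "x < c" if "x \<in> set (list_decode ts)" for x
      proof -
        have "x < ts" using that by (rule set_list_decode_less)
        also have "ts \<le> prod_encode (f, ts)" by (rule le_prod_encode_2)
        also have "\<dots> < Suc (prod_encode (f, ts))" by simp
        also have "\<dots> \<le> prod_encode (1, Suc (prod_encode (f, ts)))" by (rule le_prod_encode_2)
        finally show ?thesis unfolding c by simp
      qed
      \<comment> \<open>The inner induction follows the argument list. Its entries stay below
        \<open>c\<close>, so the outer induction hypothesis applies to each of them.\<close>
      have "H 4 (pp v (list_encode xs)) ss = 1 \<Longrightarrow> \<forall>x \<in> set xs. x < c \<Longrightarrow>
        \<exists>us ws. xs = map code_trm us \<and> ss = list_encode (map code_srt ws) \<and>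
          list_all2 (has_sort (set \<Sigma>)) us ws \<and> (v = 0 \<longrightarrow> (\<forall>u \<in> set us. ground u))" for xs
      proof (induction xs arbitrary: ss)
        case Nil
        from trms[rule_format, OF Nil.prems(1)] show ?case by simp
      next
        case (Cons x xs)
        from trms[rule_format, OF Cons.prems(1)] obtain s r
          where ss: "ss = Suc (prod_encode (s, r))"
            and x: "H 3 (pp v x) s = 1" and xs: "H 4 (pp v (list_encode xs)) r = 1"
          by auto
        obtain u w where "x = code_trm u" "s = code_srt w"
          "has_sort (set \<Sigma>) u w" "v = 0 \<longrightarrow> ground u"
          using less.IH[OF _ x] Cons.prems(2) by auto
        moreover obtain us ws where "xs = map code_trm us" "r = list_encode (map code_srt ws)"
          "list_all2 (has_sort (set \<Sigma>)) us ws" "v = 0 \<longrightarrow> (\<forall>u \<in> set us. ground u)"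
          using Cons.IH[OF xs] Cons.prems(2) by auto
        ultimately show ?case using ss
          by (intro exI[of _ "u # us"] exI[of _ "w # ws"]) simp
      qed
      from this[of "list_decode ts"] ts ts_less obtain us ws
        where us: "list_decode ts = map code_trm us" "ss = list_encode (map code_srt ws)"
          "list_all2 (has_sort (set \<Sigma>)) us ws" "v = 0 \<longrightarrow> (\<forall>u \<in> set us. ground u)"
        by auto
      have "ss = list_encode (map code_srt (arg_sorts g))" and s: "s = code_srt (res_sort g)"
        using symbol_type_codeD[OF ty g(2)] .
      with us(2) have "ws = arg_sorts g"
        by (simp add: list_encode_eq inj_map_eq_map[OF inj_code_srt])
      moreover have "ts = list_encode (map code_trm us)" using us(1) by (metis list_decode_inverse)
      ultimately show ?thesis using us g s c
        by (intro exI[of _ "App g us"] exI[of _ "res_sort g"]) (simp add: code_trm_App)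
    qed
  qed
  have "\<forall>eq \<in> set (list_decode E). eq \<in> range code_equation"
  proof
    fix eq assume "eq \<in> set (list_decode E)"
    then have "mem_code eq E = 1" by (simp add: mem_code_def)
    with eqs trm' obtain l r where "eq = prod_encode (code_trm l, code_trm r)" by metis
    then have "eq = code_equation (l, r)" by simp
    then show "eq \<in> range code_equation" by blast
  qed
  then obtain Eq where "list_decode E = map code_equation Eq"
    unfolding lists_range_iff by blast
  then have E: "E = list_encode (map code_equation Eq)" by (metis list_decode_inverse)
  have spec: "\<exists>s. has_sort (set \<Sigma>) l s \<and> has_sort (set \<Sigma>) r s" if "(l, r) \<in> set Eq" for l r
  proof -
    have "mem_code (prod_encode (code_trm l, code_trm r)) E = 1"
      unfolding E mem_code_eq_1 using that by force
    with eqs obtain s where "H 3 (pp 1 (code_trm l)) s = 1" "H 3 (pp 1 (code_trm r)) s = 1"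
      by (metis prod.inject prod_encode_eq)
    with trm' show ?thesis by (metis injD inj_code_srt inj_code_trm)
  qed
  obtain u where u: "t = code_trm u" "has_sort (set \<Sigma>) u StreamSort" "ground u"
    using trm'[OF t] by (metis code_srt.simps(2) injD inj_code_srt)
  have "set \<Sigma> \<supseteq> {Zero, One, Cons}"
    using base memS[of Zero] memS[of One] memS[of Cons] by (simp only: code_symbol.simps) simp
  with u spec have "valid_spec_term (\<Sigma>, Eq, u)"
    by (auto simp: bitstream_signature_def bitstream_spec_def)
  moreover have "n = code_spec_term (\<Sigma>, Eq, u)"
    using n S E u by (simp only: code_spec_term.simps)
  ultimately show ?thesis by blast
qed

text \<open>The witness uses the intended relations themselves: being inductively defined, they
  satisfy the implications that unfold them once.\<close>

lemma validity_complete: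
  assumes "valid_spec_term p"
  shows "\<exists>H. validity H (code_spec_term p)"
proof -
  obtain \<Sigma> E t where p: "p = (\<Sigma>, E, t)" by (cases p)
  define R where "R v c s \<longleftrightarrow> (\<exists>u w. c = code_trm u \<and> s = code_srt w \<and>
    has_sort (set \<Sigma>) u w \<and> (v = 1 \<or> ground u))" for v c s :: nat
  define Rs where "Rs v c s \<longleftrightarrow> (\<exists>us ws. c = list_encode (map code_trm us) \<and>
    s = list_encode (map code_srt ws) \<and>
    list_all2 (has_sort (set \<Sigma>)) us ws \<and> (v = 1 \<or> (\<forall>u \<in> set us. ground u)))" for v c s :: nat
  define H :: "nat \<Rightarrow> nat \<Rightarrow> nat \<Rightarrow> nat" where
    "H = (\<lambda>_ _ _. 0)(0 := \<lambda>x y. prod_encode (x, y), 1 := mem_code,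
       2 := \<lambda>ss _. of_bool (\<exists>us. ss = list_encode (map code_srt us)),
       3 := \<lambda>n s. of_bool (\<exists>v c. n = pp v c \<and> R v c s),
       4 := \<lambda>n s. of_bool (\<exists>v c. n = pp v c \<and> Rs v c s))"
  have H: "list_coding H" by (simp add: list_coding_iff H_def)
  have memS: "mem_code f (list_encode (map code_symbol \<Sigma>)) = 1 \<longleftrightarrow> f \<in> code_symbol ` set \<Sigma>" for f
    by (simp only: mem_code_eq_1 set_map)
  have memE: "mem_code f (list_encode (map code_equation E)) = 1 \<longleftrightarrow> f \<in> code_equation ` set E" for f
    by (simp only: mem_code_eq_1 set_map)
  have H2: "H 2 ss y = 1 \<longleftrightarrow> (\<exists>us. ss = list_encode (map code_srt us))"
    and H3: "H 3 (pp v c) s = 1 \<longleftrightarrow> R v c s" and H4: "H 4 (pp v c) s = 1 \<longleftrightarrow> Rs v c s" for ss y v c s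
    by (auto simp: H_def)
  have val: "{Zero, One, Cons} \<subseteq> set \<Sigma>" "\<forall>(l, r) \<in> set E. \<exists>s. has_sort (set \<Sigma>) l s \<and> has_sort (set \<Sigma>) r s"
    "has_sort (set \<Sigma>) t StreamSort" "ground t"
    using assms by (auto simp: p bitstream_signature_def bitstream_spec_def)
  have "validity H (code_spec_term p)"
    unfolding validity_def list_coding_pair[OF H] list_coding_mem[OF H] list_coding_seq[OF H]
      code_srt_cases H2 H3 H4
  proof (rule conjI[OF H], rule exI[of _ "list_encode (map code_symbol \<Sigma>)"],
      rule exI[of _ "list_encode (map code_equation E)"], rule exI[of _ "code_trm t"],
      unfold memS memE, intro conjI)
    show "code_spec_term p = list_encode [list_encode (map code_symbol \<Sigma>),
      list_encode (map code_equation E), code_trm t]" by (simp only: p code_spec_term.simps)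
    show "list_encode [0] \<in> code_symbol ` set \<Sigma>" "list_encode [1] \<in> code_symbol ` set \<Sigma>"
      "list_encode [2] \<in> code_symbol ` set \<Sigma>"
      using val(1) by (auto simp del: list_encode.simps simp: image_iff intro: bexI[of _ Zero]
         bexI[of _ One] bexI[of _ Cons])
    show "\<forall>f. f \<in> code_symbol ` set \<Sigma> \<longrightarrow> f = list_encode [0] \<or> f = list_encode [1] \<or>
      f = list_encode [2] \<or> (\<exists>i ss s. f = list_encode [3, i, ss, s] \<and> s \<in> range code_srt \<and>
        (\<exists>us. ss = list_encode (map code_srt us)))"
    proof (intro allI impI)
      fix f assume "f \<in> code_symbol ` set \<Sigma>"
      then obtain g where "f = code_symbol g" by blast
      then show "f = list_encode [0] \<or> f = list_encode [1] \<or>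
        f = list_encode [2] \<or> (\<exists>i ss s. f = list_encode [3, i, ss, s] \<and> s \<in> range code_srt \<and>
        (\<exists>us. ss = list_encode (map code_srt us)))"
        by (cases g) (simp del: list_encode.simps, blast?)+
    qed
    show "\<forall>ss. (\<exists>us. ss = list_encode (map code_srt us)) \<longrightarrow> ss = 0 \<or>
      (\<exists>s r. ss = Suc (prod_encode (s, r)) \<and> s \<in> range code_srt \<and>
         (\<exists>us. r = list_encode (map code_srt us)))"
    proof (intro allI impI, elim exE)
      fix ss us assume "ss = list_encode (map code_srt us)"
      then show "ss = 0 \<or> (\<exists>s r. ss = Suc (prod_encode (s, r)) \<and> s \<in> range code_srt \<and>
         (\<exists>us. r = list_encode (map code_srt us)))"
        by (cases us) auto
    qed
    show "\<forall>eq. eq \<in> code_equation ` set E \<longrightarrow>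
      (\<exists>l r s. eq = prod_encode (l, r) \<and> R 1 l s \<and> R 1 r s)"
      using val(2) by (fastforce simp: R_def)
    show "R 0 (code_trm t) 1"
      using val(3,4) unfolding R_def by (intro exI[of _ t] exI[of _ StreamSort]) simp
    show "\<forall>v c s. R v c s \<longrightarrow> v = 1 \<and> s \<in> range code_srt \<and> (\<exists>x. c = list_encode [0, x, s]) \<or>
      (\<exists>f ts ss. c = Suc (prod_encode (1, Suc (prod_encode (f, ts)))) \<and> f \<in> code_symbol ` set \<Sigma> \<and>
         Rs v ts ss \<and>
         (f = list_encode [0] \<and> ss = 0 \<and> s = 0 \<or> f = list_encode [1] \<and> ss = 0 \<and> s = 0 \<or>
          f = list_encode [2] \<and> ss = list_encode [0, 1] \<and> s = 1 \<or>
          (\<exists>i. f = list_encode [3, i, ss, s])))" (is "\<forall>v c s. _ \<longrightarrow> ?Q v c s")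
    proof (intro allI impI)
      fix v c s assume "R v c s"
      then obtain u w where u: "c = code_trm u" "s = code_srt w" "has_sort (set \<Sigma>) u w"
        "v = 1 \<or> ground u" by (auto simp: R_def)
      show "?Q v c s"
      proof (cases u)
        case (Var x w')
        with u show ?thesis by (intro disjI1) (auto simp del: list_encode.simps)
      next
        case (App f ts)
        have "Rs v (list_encode (map code_trm ts)) (list_encode (map code_srt (arg_sorts f)))"
          using u App by (auto simp: Rs_def)
        with u App show ?thesis
          by (intro disjI2 exI[of _ "code_symbol f"] exI[of _ "list_encode (map code_trm ts)"]
              exI[of _ "list_encode (map code_srt (arg_sorts f))"] conjI symbol_type_code[of _ f])
            (simp_all add: code_trm_App del: code_trm.simps)
      qed
    qed
    show "\<forall>v ts ss. Rs v ts ss \<longrightarrow> ts = 0 \<and> ss = 0 \<or>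
      (\<exists>c l s r. ts = Suc (prod_encode (c, l)) \<and> ss = Suc (prod_encode (s, r)) \<and> R v c s \<and> Rs v l r)"
      (is "\<forall>v ts ss. _ \<longrightarrow> ?Q v ts ss")
    proof (intro allI impI)
      fix v ts ss assume "Rs v ts ss"
      then obtain us ws where u: "ts = list_encode (map code_trm us)" "ss = list_encode (map code_srt ws)"
        "list_all2 (has_sort (set \<Sigma>)) us ws" "v = 1 \<or> (\<forall>u \<in> set us. ground u)"
        by (auto simp: Rs_def)
      show "?Q v ts ss"
      proof (cases us)
        case Nil
        with u show ?thesis by simp
      next
        case (Cons a us')
        with u obtain w ws' where ws: "ws = w # ws'" by (cases ws) auto
        have "R v (code_trm a) (code_srt w)" using u Cons ws by (auto simp: R_def)
        moreover have "Rs v (list_encode (map code_trm us')) (list_encode (map code_srt ws'))"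
          using u Cons ws by (auto simp: Rs_def)
        ultimately show ?thesis using u Cons ws by auto
      qed
    qed
  qed
  then show ?thesis by blast
qed

section \<open>Countable stream algebras\<close>

text \<open>Every number decodes to a value of the carrier, for bits by reading each nonzero number
  as \<open>True\<close>. Arbitrary lists of numbers can therefore serve as coded assignments and
  argument lists.\<close>

fun dec :: "(nat \<Rightarrow> nat \<Rightarrow> bool) \<Rightarrow> srt \<Rightarrow> nat \<Rightarrow> val" where
  "dec str BitSort n = BitVal (n \<noteq> 0)"
| "dec str StreamSort i = StreamVal (str i)"

fun enc :: "(nat \<Rightarrow> nat \<Rightarrow> bool) \<Rightarrow> val \<Rightarrow> nat" where
  "enc str (BitVal b) = of_bool b"
| "enc str (StreamVal \<sigma>) = inv str \<sigma>"

fun tvars :: "trm \<Rightarrow> (nat \<times> srt) set" where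
  "tvars (Var x s) = {(x, s)}"
| "tvars (App f ts) = (\<Union>t \<in> set ts. tvars t)"

lemma finite_tvars: "finite (tvars t)"
  by (induction t) auto

lemma tvars_ground: "ground t \<Longrightarrow> tvars t = {}"
  by (induction t) auto

lemma eval_trm_cong:
  "(\<And>x s. (x, s) \<in> tvars t \<Longrightarrow> \<alpha> x s = \<beta> x s) \<Longrightarrow> eval_trm I \<alpha> t = eval_trm I \<beta> t"
proof (induction t)
  case (App f ts)
  have "eval_trm I \<alpha> u = eval_trm I \<beta> u" if "u \<in> set ts" for u
    using App.IH[OF that] App.prems that by auto
  then show ?case by (simp cong: map_cong)
qed simp

lemma eval_trm_ground: "ground t \<Longrightarrow> eval_trm I \<alpha> t = eval_trm I \<beta> t"
  by (rule eval_trm_cong) (simp add: tvars_ground)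

lemma dec_in_carrier: "dec str s n \<in> carrier (range str) s"
  by (cases s) auto

lemma dec_enc: "v \<in> carrier (range str) s \<Longrightarrow> dec str s (enc str v) = v"
  by (cases s) (auto simp: f_inv_into_f)

lemma enc_dec: "inj str \<Longrightarrow> s = BitSort \<longrightarrow> n = 0 \<or> n = 1 \<Longrightarrow> enc str (dec str s n) = n"
  by (cases s) auto

lemma map_dec_enc:
  "list_all2 (\<lambda>v s. v \<in> carrier (range str) s) vs ss \<Longrightarrow>
    map2 (dec str) ss (map (enc str) vs) = vs"
  by (induction rule: list_all2_induct) (auto simp: dec_enc)

lemma map2_dec_in_carrier:
  "length ns = length ss \<Longrightarrow>
    list_all2 (\<lambda>v s. v \<in> carrier (range str) s) (map2 (dec str) ss ns) ss"
  by (induction ns ss rule: list_induct2) (auto simp: dec_in_carrier)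

lemma stream_algebra_closed:
  "stream_algebra \<Sigma> AS I \<Longrightarrow> f \<in> \<Sigma> \<Longrightarrow>
    list_all2 (\<lambda>v s. v \<in> carrier AS s) vs (arg_sorts f) \<Longrightarrow> I f vs \<in> carrier AS (res_sort f)"
  unfolding stream_algebra_def by blast

lemma stream_algebra_Cons:
  "stream_algebra \<Sigma> AS I \<Longrightarrow> \<sigma> \<in> AS \<Longrightarrow>
    I Cons [BitVal b, StreamVal \<sigma>] = StreamVal (case_nat b \<sigma>)"
  unfolding stream_algebra_def by blast

lemma eval_trm_in_carrier:
  assumes "stream_algebra \<Sigma> AS I" and "has_sort \<Sigma> t s"
    and "\<And>x s. (x, s) \<in> tvars t \<Longrightarrow> \<alpha> x s \<in> carrier AS s"
  shows "eval_trm I \<alpha> t \<in> carrier AS s"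
  using assms(2,3)
proof (induction t arbitrary: s)
  case (App f ts)
  then have ts: "list_all2 (has_sort \<Sigma>) ts (arg_sorts f)" and f: "f \<in> \<Sigma>" "s = res_sort f"
    by auto
  have "list_all2 (\<lambda>v s. v \<in> carrier AS s) (map (eval_trm I \<alpha>) ts) (arg_sorts f)"
    unfolding list.rel_map
    by (rule list.rel_mono_strong[OF ts]) (use App in \<open>force intro: App.IH\<close>)
  with f show ?case using assms(1) by (simp add: stream_algebra_def)
qed simp

lemma modelsD:
  "models AS I E \<Longrightarrow> (l, r) \<in> E \<Longrightarrow> (\<And>x s. \<alpha> x s \<in> carrier AS s) \<Longrightarrow>
    eval_trm I \<alpha> l = eval_trm I \<alpha> r"
  unfolding models_def by blast

text \<open>Serves both directions of the coding: reading an algebra off \<open>H\<close>, and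
  building \<open>H\<close> from an algebra. The agreement \<open>int\<close> is available only at
  arguments from the carriers, which is why the term has to be sorted.\<close>

lemma coded_eval:
  assumes H: "list_coding H"
    and ev: "\<And>a f ts. H 5 a (Suc (prod_encode (1, Suc (prod_encode (f, ts))))) = H 4 f (H 6 a ts)"
    and evl: "\<And>a. H 6 a 0 = 0"
      "\<And>a c l. H 6 a (Suc (prod_encode (c, l))) = Suc (prod_encode (H 5 a c, H 6 a l))"
    and alg: "stream_algebra \<Sigma> AS I"
    and int: "\<And>f vs. f \<in> \<Sigma> \<Longrightarrow> list_all2 (\<lambda>v s. v \<in> carrier AS s) vs (arg_sorts f) \<Longrightarrow>
      H 4 (code_symbol f) (list_encode (map (enc str) vs)) = enc str (I f vs)"
    and vars: "\<And>x s. (x, s) \<in> tvars u \<Longrightarrow>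
      \<alpha> x s \<in> carrier AS s \<and> H 5 a (code_trm (Var x s)) = enc str (\<alpha> x s)"
    and "has_sort \<Sigma> u s"
  shows "H 5 a (code_trm u) = enc str (eval_trm I \<alpha> u)"
  using vars \<open>has_sort \<Sigma> u s\<close>
proof (induction u arbitrary: s)
  case (App f ts)
  have sorted: "list_all2 (has_sort \<Sigma>) ts (arg_sorts f)" and f: "f \<in> \<Sigma>"
    using App.prems by auto
  have IH: "H 5 a (code_trm t) = enc str (eval_trm I \<alpha> t)" if "t \<in> set ts" for t
    using App.IH[OF that] App.prems(1) sorted that
    by (metis (no_types, lifting) UN_I in_set_conv_nth list_all2_conv_all_nth tvars.simps(2))
  have evl': "H 6 a (list_encode xs) = list_encode (map (H 5 a) xs)" for xs
    by (induction xs) (simp_all add: evl)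
  have "list_all2 (\<lambda>v s. v \<in> carrier AS s) (map (eval_trm I \<alpha>) ts) (arg_sorts f)"
    unfolding list.rel_map
    by (rule list.rel_mono_strong[OF sorted], rule eval_trm_in_carrier[OF alg])
      (use App.prems in auto)
  from int[OF f this] have "enc str (I f (map (eval_trm I \<alpha>) ts)) =
    H 4 (code_symbol f) (list_encode (map (H 5 a) (map code_trm ts)))"
    using IH by (simp add: comp_def cong: map_cong)
  then show ?case by (simp only: code_trm_App ev evl' eval_trm.simps)
qed simp

lemma coded_model_sound:
  assumes val: "valid_spec_term p" and M: "coded_model H (code_spec_term p) \<tau>"
  shows "(\<lambda>k. \<tau> k \<noteq> 0) \<in> solutions p"
proof -
  obtain \<Sigma> E t where p: "p = (\<Sigma>, E, t)" by (cases p)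
  have H: "list_coding H" using M by (simp add: coded_model_def)
  obtain S' E' t' where p': "code_spec_term p = list_encode [S', E', t']"
    and lk: "\<forall>x l. H 2 (Suc (prod_encode (x, l))) 0 = x"
       "\<forall>x l i. H 2 (Suc (prod_encode (x, l))) (Suc i) = H 2 l i"
    and bits: "\<forall>i k. H 3 i k = 0 \<or> H 3 i k = 1"
    and inj: "\<forall>i j. (\<forall>k. H 3 i k = H 3 j k) \<longrightarrow> i = j"
    and zero: "H 4 (list_encode [0]) 0 = 0"
    and one: "H 4 (list_encode [1]) 0 = 1"
    and cons0: "\<forall>b i. b = 0 \<or> b = 1 \<longrightarrow> H 3 (H 4 (list_encode [2]) (list_encode [b, i])) 0 = b"
    and consS: "\<forall>b i k. b = 0 \<or> b = 1 \<longrightarrow>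
      H 3 (H 4 (list_encode [2]) (list_encode [b, i])) (Suc k) = H 3 i k"
    and bitf: "\<forall>f ss v. H 4 (list_encode [3, f, ss, 0]) v = 0 \<or> H 4 (list_encode [3, f, ss, 0]) v = 1"
    and ev0: "\<forall>a x. H 2 a (x + x) = 0 \<longrightarrow> H 5 a (list_encode [0, x, 0]) = 0"
    and ev0': "\<forall>a x. H 2 a (x + x) \<noteq> 0 \<longrightarrow> H 5 a (list_encode [0, x, 0]) = 1"
    and ev1: "\<forall>a x. H 5 a (list_encode [0, x, 1]) = H 2 a (Suc (x + x))"
    and ev: "\<forall>a f ts. H 5 a (Suc (prod_encode (1, Suc (prod_encode (f, ts))))) = H 4 f (H 6 a ts)"
    and evl: "\<forall>a. H 6 a 0 = 0"
      "\<forall>a c l. H 6 a (Suc (prod_encode (c, l))) = Suc (prod_encode (H 5 a c, H 6 a l))"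
    and eqs: "\<forall>l r. mem_code (prod_encode (l, r)) E' = 1 \<longrightarrow> (\<forall>a. H 5 a l = H 5 a r)"
    and t': "\<forall>k. H 3 (H 5 0 t') k = 0 \<longleftrightarrow> \<tau> k = 0"
    using M[unfolded coded_model_def list_coding_pair[OF H] list_coding_mem[OF H]
        list_coding_seq[OF H]]
    by (elim conjE exE) (rule that; assumption)
  note lk = lk[rule_format] and bits = bits[rule_format] and inj = inj[THEN spec, THEN spec, THEN mp]
    and cons0 = cons0[rule_format] and consS = consS[rule_format] and bitf = bitf[rule_format]
    and ev0 = ev0[rule_format] and ev0' = ev0'[rule_format] and ev1 = ev1[rule_format]
    and ev = ev[rule_format] and evl = evl[rule_format] and eqs = eqs[rule_format]
    and t' = t'[rule_format]
  have E': "E' = list_encode (map code_equation E)" and t'_eq: "t' = code_trm t"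
    using p' by (simp_all only: p code_spec_term.simps list_encode_eq list.inject)
  define str where "str i k \<longleftrightarrow> H 3 i k \<noteq> 0" for i k
  have inj_str: "inj str"
  proof (rule injI)
    fix i j assume "str i = str j"
    then have "\<forall>k. H 3 i k = H 3 j k" unfolding fun_eq_iff str_def by (metis bits)
    then show "i = j" by (rule inj)
  qed
  define I where "I f vs = dec str (res_sort f) (H 4 (code_symbol f) (list_encode (map (enc str) vs)))"
    for f vs
  have cons: "I Cons [BitVal b, StreamVal (str i)] = StreamVal (case_nat b (str i))" for b i
  proof -
    have "str (H 4 (list_encode [2]) (list_encode [of_bool b, i])) k = case_nat b (str i) k" for k
      using cons0[of "of_bool b"] consS[of "of_bool b"] by (cases k; cases b) (auto simp: str_def)
    then show ?thesis
      by (simp add: I_def fun_eq_iff inv_f_f[OF inj_str] del: list_encode.simps)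
  qed
  have alg: "stream_algebra (set \<Sigma>) (range str) I"
    unfolding stream_algebra_def
  proof (intro conjI ballI allI impI)
    show "I Zero [] = BitVal False" "I One [] = BitVal True"
      using zero one by (simp_all add: I_def)
    fix x \<sigma> assume "\<sigma> \<in> range str"
    then show "I Cons [BitVal x, StreamVal \<sigma>] = StreamVal (case_nat x \<sigma>)"
      using cons by auto
  qed (auto simp: I_def dec_in_carrier)
  \<comment> \<open>Decoding and encoding again turns a bit code into 0 or 1, so bit-valued symbols
    must already take these values in \<open>H 4\<close>.\<close>
  have int: "H 4 (code_symbol f) (list_encode (map (enc str) vs)) = enc str (I f vs)"
    if vs: "list_all2 (\<lambda>v s. v \<in> carrier (range str) s) vs (arg_sorts f)" for f vs
  proof -
    have "H 4 (code_symbol f) (list_encode (map (enc str) vs)) = 0 \<or>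
      H 4 (code_symbol f) (list_encode (map (enc str) vs)) = 1" if "res_sort f = BitSort"
      using that zero one bitf vs by (cases f) (auto simp del: list_encode.simps(2))
    then show ?thesis unfolding I_def using inj_str by (intro enc_dec[symmetric]) blast+
  qed
  note coded_eval' = coded_eval[OF H ev evl alg int]
  have "eval_trm I \<alpha> l = eval_trm I \<alpha> r"
    if \<alpha>: "\<And>x s. \<alpha> x s \<in> carrier (range str) s" and lr: "(l, r) \<in> set E" for \<alpha> l r
  proof -
    define index where "index x s = x + x + code_srt s" for x s
    obtain s where s: "has_sort (set \<Sigma>) l s" "has_sort (set \<Sigma>) r s"
      using val lr by (auto simp: p bitstream_spec_def)
    \<comment> \<open>A coded assignment is a finite list, so it can match a given assignment only
      on finitely many variables; those of the two sides suffice.\<close>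
    have "finite ((\<lambda>(x, s). index x s) ` (tvars l \<union> tvars r))"
      using finite_tvars by blast
    then obtain N where "\<forall>i \<in> (\<lambda>(x, s). index x s) ` (tvars l \<union> tvars r). i < N"
      unfolding finite_nat_set_iff_bounded ..
    then have N: "index x s < N" if "(x, s) \<in> tvars l \<union> tvars r" for x s
      using that by blast
    define val where "val i = enc str (\<alpha> (i div 2) (if even i then BitSort else StreamSort))" for i
    have val: "val (index x s) = enc str (\<alpha> x s)" for x s
      by (cases s) (auto simp: val_def index_def)
    define a where "a = list_encode (map val [0..<N])"
    have lk': "i < length xs \<Longrightarrow> H 2 (list_encode xs) i = xs ! i" for i xs
      by (induction xs arbitrary: i) (auto simp: lk nth_Cons split: nat.split)
    have a: "H 2 a (index x s) = enc str (\<alpha> x s)" if "(x, s) \<in> tvars l \<union> tvars r" for x s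
      using N[OF that] by (simp add: a_def lk' val)
    have vars: "\<alpha> x s \<in> carrier (range str) s \<and> H 5 a (code_trm (Var x s)) = enc str (\<alpha> x s)"
      if "(x, s) \<in> tvars l \<union> tvars r" for x s
    proof (intro conjI \<alpha>)
      show "H 5 a (code_trm (Var x s)) = enc str (\<alpha> x s)"
      proof (cases s)
        case BitSort
        with \<alpha>[of x s] obtain b where "\<alpha> x s = BitVal b" by auto
        with a[OF that] BitSort ev0[of a x] ev0'[of a x] show ?thesis
          by (cases b) (simp_all add: index_def del: list_encode.simps)
      next
        case StreamSort
        with a[OF that] ev1[of a x] show ?thesis by (simp add: index_def del: list_encode.simps)
      qed
    qed
    have "H 5 a (code_trm l) = enc str (eval_trm I \<alpha> l)"
      "H 5 a (code_trm r) = enc str (eval_trm I \<alpha> r)"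
      using coded_eval'[OF _ vars s(1)] coded_eval'[OF _ vars s(2)] by auto
    moreover have "H 5 a (code_trm l) = H 5 a (code_trm r)"
      by (rule eqs) (use lr in \<open>force simp: E' simp del: One_nat_def\<close>)
    moreover have "eval_trm I \<alpha> l \<in> carrier (range str) s" "eval_trm I \<alpha> r \<in> carrier (range str) s"
      using eval_trm_in_carrier[OF alg] s \<alpha> by blast+
    ultimately show ?thesis by (metis dec_enc)
  qed
  then have "models (range str) I (set E)" by (auto simp: models_def)
  moreover have "eval_trm I (\<lambda>_ _. undefined) t = StreamVal (\<lambda>k. \<tau> k \<noteq> 0)"
  proof -
    define \<alpha> where "\<alpha> x s = dec str s 0" for x :: nat and s
    have t: "has_sort (set \<Sigma>) t StreamSort" "ground t" using val by (auto simp: p)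
    have "H 5 0 t' = enc str (eval_trm I \<alpha> t)"
      unfolding t'_eq by (rule coded_eval'[OF _ _ t(1)]) (simp_all add: tvars_ground[OF t(2)])
    moreover have "eval_trm I \<alpha> t \<in> carrier (range str) StreamSort"
      by (rule eval_trm_in_carrier[OF alg t(1)]) (simp add: tvars_ground[OF t(2)])
    ultimately have "eval_trm I \<alpha> t = dec str StreamSort (H 5 0 t')" by (simp only: dec_enc)
    also have "\<dots> = StreamVal (\<lambda>k. \<tau> k \<noteq> 0)" using t' by (simp add: str_def fun_eq_iff)
    finally show ?thesis using eval_trm_ground[OF t(2)] by metis
  qed
  ultimately show ?thesis using alg by (auto simp: p sol_def)
qed

instance srt :: countable by countable_datatype
instance symbol :: countable by countable_datatype
instance trm :: countable by countable_datatype

text \<open>An injective enumeration by all natural numbers, as \<open>coded_model\<close> demands,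
  exists only for an infinite carrier. On a finite one, prepending either bit would be injective and
  hence onto, so some stream would begin with both bits.\<close>

lemma infinite_stream_carrier:
  assumes "stream_algebra \<Sigma> AS I" "Cons \<in> \<Sigma>"
  shows "infinite AS"
proof
  assume fin: "finite AS"
  have closed: "case_nat b \<sigma> \<in> AS" if "\<sigma> \<in> AS" for b \<sigma>
    using stream_algebra_closed[OF assms, of "[BitVal b, StreamVal \<sigma>]"]
      stream_algebra_Cons[OF assms(1) that] that by auto
  have inj: "inj_on (case_nat b) AS" for b :: bool
    by (rule inj_onI) (metis (no_types) old.nat.simps(5) ext)
  have "case_nat b ` AS = AS" for b
    by (rule endo_inj_surj[OF fin _ inj]) (use closed in auto)
  moreover obtain \<sigma> where "\<sigma> \<in> AS" using assms by (auto simp: stream_algebra_def)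
  ultimately obtain \<rho> \<rho>' where "case_nat True \<rho> = \<sigma>" "case_nat False \<rho>' = \<sigma>" by (metis imageE)
  then show False by (metis old.nat.simps(4))
qed

text \<open>Downward Loewenheim--Skolem: the values of terms form a countable subalgebra.\<close>

lemma countable_submodel:
  assumes alg: "stream_algebra \<Sigma> AS I" and mod: "models AS I E" and \<Sigma>: "{Zero, One, Cons} \<subseteq> \<Sigma>"
  obtains str :: "nat \<Rightarrow> nat \<Rightarrow> bool" where "inj str" "stream_algebra \<Sigma> (range str) I" "models (range str) I E"
proof -
  obtain \<sigma>0 where \<sigma>0: "\<sigma>0 \<in> AS" using alg by (auto simp: stream_algebra_def)
  \<comment> \<open>A signature may have no ground stream terms. Evaluating open terms with
    \<open>\<sigma>0\<close> at every stream variable keeps the generated carrier nonempty.\<close>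
  define \<alpha> where "\<alpha> x s = (case s of BitSort \<Rightarrow> BitVal False | StreamSort \<Rightarrow> StreamVal \<sigma>0)"
    for x :: nat and s
  define T where "T s = {t. has_sort \<Sigma> t s}" for s
  define C where "C = {\<sigma>. \<exists>t. has_sort \<Sigma> t StreamSort \<and> eval_trm I \<alpha> t = StreamVal \<sigma>}"
  have \<alpha>: "\<alpha> x s \<in> carrier AS s" for x s using \<sigma>0 by (auto simp: \<alpha>_def split: srt.split)
  have CAS: "C \<subseteq> AS"
    using eval_trm_in_carrier[OF alg, of _ StreamSort \<alpha>] \<alpha> by (force simp: C_def)
  then have carr: "v \<in> carrier AS s" if "v \<in> carrier C s" for v s
    using that by (cases s) auto
  have \<sigma>0C: "\<sigma>0 \<in> C" unfolding C_def by (auto intro!: exI[of _ "Var 0 StreamSort"] simp: \<alpha>_def)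
  have val_C: "\<exists>t. has_sort \<Sigma> t s \<and> eval_trm I \<alpha> t = v" if "v \<in> carrier C s" for v s
  proof (cases s)
    case BitSort
    with that obtain b where "v = BitVal b" by auto
    with BitSort show ?thesis using alg \<Sigma>
      by (intro exI[of _ "App (if b then One else Zero) []"]) (auto simp: stream_algebra_def)
  next
    case StreamSort
    with that show ?thesis by (auto simp: C_def)
  qed
  have closed: "I f vs \<in> carrier C (res_sort f)"
    if f: "f \<in> \<Sigma>" and vs: "list_all2 (\<lambda>v s. v \<in> carrier C s) vs (arg_sorts f)" for f vs
  proof -
    have "\<exists>ts. list_all2 (has_sort \<Sigma>) ts (arg_sorts f) \<and> map (eval_trm I \<alpha>) ts = vs"
      using vs
    proof (induction rule: list_all2_induct)
      case (Cons v vs s ss)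
      obtain u us where "has_sort \<Sigma> u s" "eval_trm I \<alpha> u = v"
        "list_all2 (has_sort \<Sigma>) us ss" "map (eval_trm I \<alpha>) us = vs"
        using val_C Cons by blast
      then show ?case by (intro exI[of _ "u # us"]) simp
    qed simp
    then obtain ts where ts: "list_all2 (has_sort \<Sigma>) ts (arg_sorts f)" "map (eval_trm I \<alpha>) ts = vs"
      by blast
    have srt: "has_sort \<Sigma> (App f ts) (res_sort f)" and val: "eval_trm I \<alpha> (App f ts) = I f vs"
      using ts f by auto
    have "I f vs \<in> carrier AS (res_sort f)"
      using eval_trm_in_carrier[OF alg srt, of \<alpha>] \<alpha> val by simp
    then show ?thesis
    proof (cases "res_sort f")
      case StreamSort
      then obtain \<sigma> where "I f vs = StreamVal \<sigma>"
        using \<open>I f vs \<in> carrier AS (res_sort f)\<close> by auto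
      moreover from this have "\<sigma> \<in> C"
        using srt val StreamSort unfolding C_def by (simp only: mem_Collect_eq) metis
      ultimately show ?thesis using StreamSort by simp
    qed auto
  qed
  have "stream_algebra \<Sigma> C I"
    using alg closed \<sigma>0C CAS unfolding stream_algebra_def by blast
  moreover have "models C I E"
    using mod carr unfolding models_def by blast
  moreover have "countable C"
  proof -
    have "StreamVal ` C \<subseteq> range (eval_trm I \<alpha>)" by (clarsimp simp: C_def) (metis rangeI)
    then have "countable (StreamVal ` C)" by (rule countable_subset) simp
    then show ?thesis by (rule countable_image_inj_on) (simp add: inj_on_def)
  qed
  ultimately show ?thesis
    using that[of "from_nat_into C"] \<Sigma> infinite_stream_carrier[of \<Sigma> C I]
    by (metis bij_betw_def bij_betw_from_nat_into insert_subset)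
qed

section \<open>Coding a given countable model\<close>

text \<open>The recursion is on numbers instead of terms, since the clauses of
  \<open>coded_model\<close> for \<open>H 5\<close> and \<open>H 6\<close> also cover numbers that
  code no well-sorted term.\<close>

function eval_code :: "(nat \<Rightarrow> nat \<Rightarrow> nat) \<Rightarrow> (nat \<Rightarrow> nat) \<Rightarrow> nat \<Rightarrow> nat" where
  "eval_code I \<alpha> c = (case list_decode c of
     [] \<Rightarrow> 0
   | k # xs \<Rightarrow>
      if k = 0 then \<alpha> c
      else case xs of [] \<Rightarrow> 0 | f # _ \<Rightarrow> I f (list_encode (map (eval_code I \<alpha>) (tl xs))))"
  by pat_completeness auto
termination
proof (relation "measure (\<lambda>(_, _, c). c)")
  fix c k xs f fs x
  assume "list_decode c = k # xs" "xs = f # fs" "x \<in> set (tl xs)"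
  then have "x \<in> set (list_decode c)" by simp
  then show "((I, \<alpha>, x), I, \<alpha>, c) \<in> measure (\<lambda>(_, _, c). c)" for I :: "nat \<Rightarrow> nat \<Rightarrow> nat" and \<alpha> :: "nat \<Rightarrow> nat"
    using set_list_decode_less by simp
qed simp

declare eval_code.simps [simp del]

lemma coded_model_complete:
  assumes val: "valid_spec_term p" and sol: "(\<lambda>k. \<tau> k \<noteq> 0) \<in> solutions p"
  shows "\<exists>H. coded_model H (code_spec_term p) \<tau>"
proof -
  obtain \<Sigma> E t where p: "p = (\<Sigma>, E, t)" by (cases p)
  have \<Sigma>: "{Zero, One, Cons} \<subseteq> set \<Sigma>" and t: "has_sort (set \<Sigma>) t StreamSort" "ground t"
    using val by (auto simp: p bitstream_signature_def)
  obtain AS I where "stream_algebra (set \<Sigma>) AS I" "models AS I (set E)"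
    and eval_t: "eval_trm I (\<lambda>_ _. undefined) t = StreamVal (\<lambda>k. \<tau> k \<noteq> 0)"
    using sol by (auto simp: p sol_def)
  then obtain str :: "nat \<Rightarrow> nat \<Rightarrow> bool" where inj_str: "inj str"
    and alg: "stream_algebra (set \<Sigma>) (range str) I" and mod: "models (range str) I (set E)"
    using countable_submodel \<Sigma> by metis
  \<comment> \<open>The default 0 for foreign symbols and wrong argument counts is a bit, so the
    clause on bit-valued symbols holds at all numbers.\<close>
  define J where "J c as = (let f = the_inv code_symbol c in
    if c \<in> code_symbol ` set \<Sigma> \<and> length (list_decode as) = length (arg_sorts f)
    then enc str (I f (map2 (dec str) (arg_sorts f) (list_decode as))) else 0)" for c as
  define lk where "lk a i = (if i < length (list_decode a) then list_decode a ! i else 0)" for a i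
  define var where "var a c = (let x = list_decode c ! 1; s = list_decode c ! 2 in
    if s = 0 then if lk a (x + x) = 0 then 0 else 1 else lk a (Suc (x + x)))" for a c
  define H :: "nat \<Rightarrow> nat \<Rightarrow> nat \<Rightarrow> nat" where
    "H = (\<lambda>_ _ _. 0)(0 := \<lambda>x y. prod_encode (x, y), 1 := mem_code, 2 := lk,
       3 := \<lambda>i k. of_bool (str i k), 4 := J, 5 := \<lambda>a. eval_code J (var a),
       6 := \<lambda>a l. list_encode (map (eval_code J (var a)) (list_decode l)))"
  have H: "list_coding H" by (simp add: list_coding_iff H_def)
  have H2: "H 2 = lk" and H3: "H 3 = (\<lambda>i k. of_bool (str i k))" and H4: "H 4 = J"
    and H5: "H 5 = (\<lambda>a. eval_code J (var a))"
    and H6: "H 6 = (\<lambda>a l. list_encode (map (eval_code J (var a)) (list_decode l)))"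
    by (simp_all add: H_def)
  have J: "J (code_symbol f) (list_encode ns) =
      enc str (I f (map2 (dec str) (arg_sorts f) ns))"
    if "f \<in> set \<Sigma>" "length ns = length (arg_sorts f)" for f ns
    using that by (simp add: J_def the_inv_f_f[OF inj_code_symbol])
  have int: "H 4 (code_symbol f) (list_encode (map (enc str) vs)) = enc str (I f vs)"
    if "f \<in> set \<Sigma>" "list_all2 (\<lambda>v s. v \<in> carrier (range str) s) vs (arg_sorts f)" for f vs
    unfolding H4 using J[OF that(1)] that(2)
    by (simp add: map_dec_enc list_all2_lengthD)
  have J_bit: "J (list_encode [3, f, ss, 0]) v = 0 \<or> J (list_encode [3, f, ss, 0]) v = 1" for f ss v
  proof (cases "list_encode [3, f, ss, 0] \<in> code_symbol ` set \<Sigma> \<and> J (list_encode [3, f, ss, 0]) v \<noteq> 0")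
    case True
    then obtain g where g: "g \<in> set \<Sigma>" "code_symbol g = list_encode [3, f, ss, 0]" by auto
    from g(2) have bit: "res_sort g = BitSort"
      by (cases g; cases "res_sort g") (auto simp: list_encode_eq simp del: list_encode.simps)
    have len: "length (list_decode v) = length (arg_sorts g)"
      using True unfolding g(2)[symmetric] J_def
      by (auto simp: the_inv_f_f[OF inj_code_symbol] Let_def split: if_splits)
    then have "I g (map2 (dec str) (arg_sorts g) (list_decode v)) \<in> carrier (range str) (res_sort g)"
      using alg g(1) map2_dec_in_carrier unfolding stream_algebra_def by blast
    with J[OF g(1) len] bit show ?thesis unfolding g(2) by auto
  qed (auto simp: J_def Let_def)
  have ev: "eval_code J (var a) (Suc (prod_encode (1, Suc (prod_encode (f, ts))))) =
      J f (list_encode (map (eval_code J (var a)) (list_decode ts)))" for a f ts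
    by (subst eval_code.simps) simp
  have ev_var: "eval_code J (var a) (list_encode [0, x, s]) = var a (list_encode [0, x, s])" for a x s
    by (subst eval_code.simps) simp
  have evH: "H 5 a (Suc (prod_encode (1, Suc (prod_encode (f, ts))))) = H 4 f (H 6 a ts)" for a f ts
    unfolding H4 H5 H6 by (rule ev)
  have evlH: "H 6 a 0 = 0" "H 6 a (Suc (prod_encode (c, l))) = Suc (prod_encode (H 5 a c, H 6 a l))"
    for a c l
    unfolding H5 H6 by simp_all
  have eval: "H 5 a (code_trm u) = enc str (eval_trm I (\<lambda>x s. dec str s (lk a (x + x + code_srt s))) u)"
    if "has_sort (set \<Sigma>) u s" for a u s
  proof (rule coded_eval[OF H evH evlH alg int _ that])
    fix x s assume "(x, s) \<in> tvars u"
    show "dec str s (lk a (x + x + code_srt s)) \<in> carrier (range str) s \<and>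
      H 5 a (code_trm (Var x s)) = enc str (dec str s (lk a (x + x + code_srt s)))"
      unfolding H5 code_trm.simps ev_var
      by (cases s) (auto simp: var_def Let_def inv_f_f[OF inj_str])
  qed
  have "coded_model H (code_spec_term p) \<tau>"
    unfolding coded_model_def list_coding_pair[OF H] list_coding_mem[OF H] list_coding_seq[OF H]
  proof (rule conjI[OF H], rule exI[of _ "list_encode (map code_symbol \<Sigma>)"],
      rule exI[of _ "list_encode (map code_equation E)"], rule exI[of _ "code_trm t"], intro conjI)
    show "code_spec_term p = list_encode [list_encode (map code_symbol \<Sigma>),
      list_encode (map code_equation E), code_trm t]" by (simp only: p code_spec_term.simps)
    show "\<forall>i j. (\<forall>k. H 3 i k = H 3 j k) \<longrightarrow> i = j"
      unfolding H3 using inj_str by (auto simp: inj_def fun_eq_iff)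
    show "H 4 (list_encode [0]) 0 = 0"
      using int[of Zero "[]"] \<Sigma> alg by (simp add: stream_algebra_def del: list_encode.simps(2)) 
    show "H 4 (list_encode [1]) 0 = 1"
      using int[of One "[]"] \<Sigma> alg by (simp add: stream_algebra_def del: list_encode.simps(2))
    have cons: "str (H 4 (list_encode [2]) (list_encode [b, i])) = case_nat (b = 1) (str i)"
      if b: "b = 0 \<or> b = 1" for b i
    proof -
      have "H 4 (list_encode [2]) (list_encode [b, i]) =
          H 4 (code_symbol Cons) (list_encode (map (enc str) [BitVal (b = 1), StreamVal (str i)]))"
        using b by (auto simp: inv_f_f[OF inj_str])
      also have "\<dots> = enc str (I Cons [BitVal (b = 1), StreamVal (str i)])"
        by (rule int) (use \<Sigma> in auto)
      finally have eq: "H 4 (list_encode [2]) (list_encode [b, i]) =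
        enc str (I Cons [BitVal (b = 1), StreamVal (str i)])" .
      \<comment> \<open>\<open>str\<close> undoes the encoding of a stream only inside the carrier,
        so closure under prepending has to be established here.\<close>
      have "list_all2 (\<lambda>v s. v \<in> carrier (range str) s) [BitVal (b = 1), StreamVal (str i)] (arg_sorts Cons)"
        by simp
      then have "I Cons [BitVal (b = 1), StreamVal (str i)] \<in> carrier (range str) (res_sort Cons)"
        using stream_algebra_closed[OF alg] \<Sigma> by blast
      moreover have I: "I Cons [BitVal (b = 1), StreamVal (str i)] = StreamVal (case_nat (b = 1) (str i))"
        by (rule stream_algebra_Cons[OF alg]) simp
      ultimately have "case_nat (b = 1) (str i) \<in> range str" by auto
      then show ?thesis unfolding eq I by (simp add: f_inv_into_f)
    qed
    show "\<forall>b i. b = 0 \<or> b = 1 \<longrightarrow> H 3 (H 4 (list_encode [2]) (list_encode [b, i])) 0 = b"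
      "\<forall>b i k. b = 0 \<or> b = 1 \<longrightarrow>
        H 3 (H 4 (list_encode [2]) (list_encode [b, i])) (Suc k) = H 3 i k"
      using cons unfolding H3 by (auto simp del: list_encode.simps)
    show "\<forall>f ss v. H 4 (list_encode [3, f, ss, 0]) v = 0 \<or> H 4 (list_encode [3, f, ss, 0]) v = 1"
      unfolding H4 using J_bit by blast
    show "\<forall>l r. mem_code (prod_encode (l, r)) (list_encode (map code_equation E)) = 1 \<longrightarrow>
      (\<forall>a. H 5 a l = H 5 a r)"
    proof (intro allI impI)
      fix l r a assume "mem_code (prod_encode (l, r)) (list_encode (map code_equation E)) = 1"
      then obtain l' r' where lr: "(l', r') \<in> set E" "l = code_trm l'" "r = code_trm r'"
        unfolding mem_code_eq_1 by auto
      obtain s where s: "has_sort (set \<Sigma>) l' s" "has_sort (set \<Sigma>) r' s"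
        using val lr by (auto simp: p bitstream_spec_def)
      have "eval_trm I (\<lambda>x s. dec str s (lk a (x + x + code_srt s))) l' =
        eval_trm I (\<lambda>x s. dec str s (lk a (x + x + code_srt s))) r'"
        using mod lr(1) by (rule modelsD) (rule dec_in_carrier)
      then show "H 5 a l = H 5 a r" using eval[OF s(1), of a] eval[OF s(2), of a] lr by simp
    qed
    show "\<forall>k. (H 3 (H 5 0 (code_trm t)) k = 0) = (\<tau> k = 0)"
    proof -
      let ?\<alpha> = "\<lambda>x s. dec str s (lk 0 (x + x + code_srt s))"
      have val: "eval_trm I ?\<alpha> t = StreamVal (\<lambda>k. \<tau> k \<noteq> 0)"
        by (rule trans[OF eval_trm_ground[OF t(2)] eval_t])
      have "eval_trm I ?\<alpha> t \<in> carrier (range str) StreamSort"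
        by (rule eval_trm_in_carrier[OF alg t(1)]) (rule dec_in_carrier)
      then have "(\<lambda>k. \<tau> k \<noteq> 0) \<in> range str" unfolding val by auto
      moreover have "H 5 0 (code_trm t) = inv str (\<lambda>k. \<tau> k \<noteq> 0)"
        using eval[OF t(1), of 0] unfolding val by simp
      ultimately have "str (H 5 0 (code_trm t)) = (\<lambda>k. \<tau> k \<noteq> 0)"
        by (simp only: f_inv_into_f)
      then show ?thesis unfolding H3 by simp
    qed
    have "H 5 a (list_encode [0, x, 0]) = (if H 2 a (x + x) = 0 then 0 else 1)"
      "H 5 a (list_encode [0, x, 1]) = H 2 a (Suc (x + x))" for a x
      unfolding H2 H5 ev_var var_def Let_def list_encode_inverse by simp_all
    then show "\<forall>a x. H 2 a (x + x) = 0 \<longrightarrow> H 5 a (list_encode [0, x, 0]) = 0"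
      "\<forall>a x. H 2 a (x + x) \<noteq> 0 \<longrightarrow> H 5 a (list_encode [0, x, 0]) = 1"
      "\<forall>a x. H 5 a (list_encode [0, x, 1]) = H 2 a (Suc (x + x))"
      by presburger+
  qed (simp_all add: H2 H3 H4 H5 H6 ev lk_def del: One_nat_def)
  then show ?thesis by blast
qed

section \<open>Membership\<close>

lemma sol_equality_problem_in_Pi12: "sol_equality_problem \<in> Pi12"
proof -
  have "n \<in> sol_equality_problem \<longleftrightarrow>
    (\<forall>f. \<exists>g. holds ((\<lambda>_ _. 0)(0 := f, 1 := g)) ((\<lambda>_. 0)(0 := n)) sol_equality_form)" for n
  proof
    assume "n \<in> sol_equality_problem"
    then obtain p q where n: "n = code_instance (p, q)" and val: "valid_spec_term p" "valid_spec_term q"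
      and sols: "solutions p = solutions q"
      by (auto simp: sol_equality_problem_def)
    obtain V W where V: "validity V (code_spec_term p)" and W: "validity W (code_spec_term q)"
      using validity_complete val by metis
    show "\<forall>f. \<exists>g. holds ((\<lambda>_ _. 0)(0 := f, 1 := g)) ((\<lambda>_. 0)(0 := n)) sol_equality_form"
    proof
      fix f
      let ?\<tau> = "\<lambda>k. blk f 2 0 k 0"
      obtain M where M: "coded_model (blk f 0) (code_spec_term p) ?\<tau> \<Longrightarrow>
          coded_model M (code_spec_term q) ?\<tau>"
        using coded_model_sound[OF val(1)] coded_model_complete[OF val(2)] sols by metis
      obtain N where N: "coded_model (blk f 1) (code_spec_term q) ?\<tau> \<Longrightarrow>
          coded_model N (code_spec_term p) ?\<tau>"
        using coded_model_sound[OF val(2)] coded_model_complete[OF val(1)] sols by metis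
      obtain g where g: "blk g = (\<lambda>_ _ _ _. 0)(0 := M, 1 := N, 2 := V, 3 := W)"
        using ex_blk by blast
      have "V 0 x y = prod_encode (x, y)" for x y
        using V by (simp add: validity_def list_coding_pair)
      then have "holds ((\<lambda>_ _. 0)(0 := f, 1 := g)) ((\<lambda>_. 0)(0 := n)) sol_equality_form"
        unfolding holds_sol_equality_form using V W M N n
        by (intro exI[of _ "code_spec_term p"] exI[of _ "code_spec_term q"])
          (simp add: g del: code_spec_term.simps)
      then show "\<exists>g. holds ((\<lambda>_ _. 0)(0 := f, 1 := g)) ((\<lambda>_. 0)(0 := n)) sol_equality_form"
        by (rule exI[of _ g])
    qed
  next
    assume *: "\<forall>f. \<exists>g. holds ((\<lambda>_ _. 0)(0 := f, 1 := g)) ((\<lambda>_. 0)(0 := n)) sol_equality_form"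
    have step: "\<exists>p q g. valid_spec_term p \<and> valid_spec_term q \<and> n = code_instance (p, q) \<and>
      (coded_model (blk f 0) (code_spec_term p) (\<lambda>k. blk f 2 0 k 0) \<longrightarrow>
       coded_model (blk g 0) (code_spec_term q) (\<lambda>k. blk f 2 0 k 0)) \<and>
      (coded_model (blk f 1) (code_spec_term q) (\<lambda>k. blk f 2 0 k 0) \<longrightarrow>
       coded_model (blk g 1) (code_spec_term p) (\<lambda>k. blk f 2 0 k 0))" for f
    proof -
      obtain g p q where V: "validity (blk g 2) p" "validity (blk g 3) q" and n: "n = blk g 2 0 p q"
        and M: "(coded_model (blk f 0) p (\<lambda>k. blk f 2 0 k 0) \<longrightarrow> coded_model (blk g 0) q (\<lambda>k. blk f 2 0 k 0))"
         "(coded_model (blk f 1) q (\<lambda>k. blk f 2 0 k 0) \<longrightarrow> coded_model (blk g 1) p (\<lambda>k. blk f 2 0 k 0))"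
        using *[rule_format, of f] unfolding holds_sol_equality_form by blast
      obtain p' q' where "valid_spec_term p'" "p = code_spec_term p'"
         "valid_spec_term q'" "q = code_spec_term q'"
        using validity_sound V by metis
      moreover from this have "n = code_instance (p', q')"
        using n V by (simp add: validity_def list_coding_pair)
      ultimately show ?thesis using M by blast
    qed
    \<comment> \<open>The formula supplies \<open>p\<close> and \<open>q\<close> separately for each
      \<open>f\<close>. One pair is fixed here, and injectivity of \<open>code_instance\<close>
      identifies all others with it.\<close>
    obtain p q where val: "valid_spec_term p" "valid_spec_term q" and n: "n = code_instance (p, q)"
      using step by blast
    have step': "\<exists>g. (coded_model (blk f 0) (code_spec_term p) (\<lambda>k. blk f 2 0 k 0) \<longrightarrow>
       coded_model (blk g 0) (code_spec_term q) (\<lambda>k. blk f 2 0 k 0)) \<and>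
      (coded_model (blk f 1) (code_spec_term q) (\<lambda>k. blk f 2 0 k 0) \<longrightarrow>
       coded_model (blk g 1) (code_spec_term p) (\<lambda>k. blk f 2 0 k 0))" for f
    proof -
      obtain p' q' g where n': "n = code_instance (p', q')"
        and g: "(coded_model (blk f 0) (code_spec_term p') (\<lambda>k. blk f 2 0 k 0) \<longrightarrow>
         coded_model (blk g 0) (code_spec_term q') (\<lambda>k. blk f 2 0 k 0)) \<and>
        (coded_model (blk f 1) (code_spec_term q') (\<lambda>k. blk f 2 0 k 0) \<longrightarrow>
         coded_model (blk g 1) (code_spec_term p') (\<lambda>k. blk f 2 0 k 0))"
        using step by blast
      have "(p', q') = (p, q)" by (rule injD[OF inj_code_instance]) (use n n' in simp)
      with g show ?thesis by blast
    qed
    have "\<sigma> \<in> solutions p \<longleftrightarrow> \<sigma> \<in> solutions q" for \<sigma>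
    proof
      assume "\<sigma> \<in> solutions p"
      then obtain M where M: "coded_model M (code_spec_term p) (\<lambda>k. of_bool (\<sigma> k))"
        using coded_model_complete[OF val(1), of "\<lambda>k. of_bool (\<sigma> k)"] by auto
      obtain f where f: "blk f = (\<lambda>_ _ _ _. 0)(0 := M, 2 := \<lambda>_ k _. of_bool (\<sigma> k))"
        using ex_blk by blast
      with step'[of f] M obtain N where "coded_model N (code_spec_term q) (\<lambda>k. of_bool (\<sigma> k))"
        by auto
      from coded_model_sound[OF val(2) this] show "\<sigma> \<in> solutions q" by simp
    next
      assume "\<sigma> \<in> solutions q"
      then obtain M where M: "coded_model M (code_spec_term q) (\<lambda>k. of_bool (\<sigma> k))"
        using coded_model_complete[OF val(2), of "\<lambda>k. of_bool (\<sigma> k)"] by auto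
      obtain f where f: "blk f = (\<lambda>_ _ _ _. 0)(1 := M, 2 := \<lambda>_ k _. of_bool (\<sigma> k))"
        using ex_blk by blast
      with step'[of f] M obtain N where "coded_model N (code_spec_term p) (\<lambda>k. of_bool (\<sigma> k))"
        by auto
      from coded_model_sound[OF val(1) this] show "\<sigma> \<in> solutions p" by simp
    qed
    with val n show "n \<in> sol_equality_problem" unfolding sol_equality_problem_def by blast
  qed
  then show ?thesis unfolding Pi12_def by blast
qed

section \<open>Recursive functions\<close>

text \<open>\<open>partial_recursive\<close> demands an equivalence with \<open>computes\<close>, so
  besides the existence of a computed value its uniqueness is needed.\<close>

lemma computes_functional: "computes r xs y \<Longrightarrow> computes r xs z \<Longrightarrow> y = z"
proof (induction arbitrary: z rule: computes.induct)
  case (4 xs gs ys f y)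
  from \<open>computes (CompF f gs) xs z\<close> obtain us
    where us: "list_all2 (\<lambda>g y. computes g xs y) gs us" and f: "computes f us z"
    by cases
  have "ys = us"
    using 4(1) us by (induction gs ys arbitrary: us rule: list_all2_induct)
      (auto simp: list_all2_Cons1)
  with f 4 show ?case by simp
next
  case (6 f g n xs y u)
  from \<open>computes (PrimRecF f g) (Suc n # xs) z\<close> obtain y'
    where y': "computes (PrimRecF f g) (n # xs) y'" "computes g (n # y' # xs) z"
    by cases
  with 6 show ?case by auto
next
  case (7 f n xs)
  from \<open>computes (MinF f) xs z\<close> have z: "computes f (z # xs) 0"
      "\<forall>m < z. \<exists>y. computes f (m # xs) (Suc y)"
    by (cases; auto)+
  show ?case
  proof (rule linorder_cases)
    assume "n < z"
    with z 7(2) show ?thesis by fastforce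
  next
    assume "z < n"
    with z 7(3) show ?thesis by fastforce
  qed
next
  case (5 f xs y g)
  from \<open>computes (PrimRecF f g) (0 # xs) z\<close> have "computes f xs z" by cases
  with 5 show ?case by blast
qed (erule computes.cases; simp)+

definition recursive :: "nat \<Rightarrow> (nat list \<Rightarrow> nat) \<Rightarrow> bool" where
  "recursive k F \<longleftrightarrow> (\<exists>r. \<forall>xs. length xs = k \<longrightarrow> computes r xs (F xs))"

lemma recursive_proj: "i < k \<Longrightarrow> recursive k (\<lambda>xs. xs ! i)"
  unfolding recursive_def by (intro exI[of _ "ProjF i"]) (auto intro: computes.intros)

lemma recursive_comp1:
  assumes "recursive 1 (\<lambda>xs. F (xs ! 0))" "recursive k G"
  shows "recursive k (\<lambda>xs. F (G xs))"
proof -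
  obtain f g where f: "\<And>xs. length xs = 1 \<Longrightarrow> computes f xs (F (xs ! 0))"
    and g: "\<And>xs. length xs = k \<Longrightarrow> computes g xs (G xs)"
    using assms unfolding recursive_def by blast
  have "computes (CompF f [g]) xs (F (G xs))" if "length xs = k" for xs
    by (rule computes.intros(4)[where ys = "[G xs]"]) (use g[OF that] f[of "[G xs]"] in auto)
  then show ?thesis unfolding recursive_def by blast
qed

lemma recursive_comp2:
  assumes "recursive 2 (\<lambda>xs. F (xs ! 0) (xs ! 1))" "recursive k G" "recursive k H"
  shows "recursive k (\<lambda>xs. F (G xs) (H xs))"
proof -
  obtain f g h where f: "\<And>xs. length xs = 2 \<Longrightarrow> computes f xs (F (xs ! 0) (xs ! 1))"
    and g: "\<And>xs. length xs = k \<Longrightarrow> computes g xs (G xs)"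
    and h: "\<And>xs. length xs = k \<Longrightarrow> computes h xs (H xs)"
    using assms unfolding recursive_def by blast
  have "computes (CompF f [g, h]) xs (F (G xs) (H xs))" if "length xs = k" for xs
    by (rule computes.intros(4)[where ys = "[G xs, H xs]"])
      (use g[OF that] h[OF that] f[of "[G xs, H xs]"] in auto)
  then show ?thesis unfolding recursive_def by blast
qed

lemma recursive_Suc: "recursive k F \<Longrightarrow> recursive k (\<lambda>xs. Suc (F xs))"
proof (rule recursive_comp1[where F = Suc])
  have "computes SuccF xs (Suc (xs ! 0))" if "length xs = 1" for xs
    using that computes.intros(2) by (auto simp: length_Suc_conv)
  then show "recursive 1 (\<lambda>xs. Suc (xs ! 0))" unfolding recursive_def by blast
qed

lemma recursive_const: "recursive k (\<lambda>_. c)"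
proof (induction c)
  case 0
  show ?case unfolding recursive_def by (auto intro: computes.intros)
qed (rule recursive_Suc)

lemma recursive_primrec:
  assumes "recursive k G" "recursive (Suc (Suc k)) H"
    and "\<And>xs. F (0 # xs) = G xs" "\<And>n xs. F (Suc n # xs) = H (n # F (n # xs) # xs)"
  shows "recursive (Suc k) F"
proof -
  obtain g h where g: "\<And>xs. length xs = k \<Longrightarrow> computes g xs (G xs)"
    and h: "\<And>xs. length xs = Suc (Suc k) \<Longrightarrow> computes h xs (H xs)"
    using assms unfolding recursive_def by blast
  have "computes (PrimRecF g h) (n # xs) (F (n # xs))" if "length xs = k" for n xs
    by (induction n) (use that g h assms(3,4) in \<open>auto intro!: computes.intros\<close>)
  then show ?thesis unfolding recursive_def
    by (intro exI[of _ "PrimRecF g h"]) (auto simp: length_Suc_conv)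
qed

lemma recursive_add:
  assumes "recursive k F" "recursive k G"
  shows "recursive k (\<lambda>xs. F xs + G xs)"
proof (rule recursive_comp2[where F = "(+)", OF _ assms])
  have "recursive (Suc 1) (\<lambda>xs. xs ! 0 + xs ! 1)"
    by (rule recursive_primrec[where G = "\<lambda>xs. xs ! 0" and H = "\<lambda>xs. Suc (xs ! 1)"])
      (auto intro: recursive_proj recursive_Suc)
  then show "recursive 2 (\<lambda>xs. xs ! 0 + xs ! 1)" by (simp add: numeral_2_eq_2)
qed

lemma recursive_prod_encode:
  assumes "recursive k F" "recursive k G"
  shows "recursive k (\<lambda>xs. prod_encode (F xs, G xs))"
proof -
  have "recursive (Suc 0) (\<lambda>xs. triangle (xs ! 0))"
    by (rule recursive_primrec[where G = "\<lambda>xs. 0" and H = "\<lambda>xs. xs ! 1 + Suc (xs ! 0)"])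
      (auto intro!: recursive_proj recursive_Suc recursive_const recursive_add)
  then have "recursive 1 (\<lambda>xs. triangle (xs ! 0))" by simp
  from recursive_add[OF recursive_comp1[where F = triangle, OF this recursive_add[OF assms]] assms(1)]
  show ?thesis by (simp add: prod_encode_def)
qed

lemma partial_recursive_total:
  assumes "recursive 1 (\<lambda>xs. F (xs ! 0))"
  shows "partial_recursive (\<lambda>n. Some (F n))"
proof -
  obtain r where r: "\<And>xs. length xs = 1 \<Longrightarrow> computes r xs (F (xs ! 0))"
    using assms unfolding recursive_def by blast
  have "Some (F n) = Some y \<longleftrightarrow> computes r [n] y" for n y
    using r[of "[n]"] computes_functional by auto
  then show ?thesis unfolding partial_recursive_def by blast
qed

lemma many_one_reducible_total:
  assumes "recursive 1 (\<lambda>xs. F (xs ! 0))" "\<And>n. n \<in> P \<longleftrightarrow> F n \<in> Q"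
  shows "many_one_reducible P Q"
  unfolding many_one_reducible_def
  using partial_recursive_total[OF assms(1)] assms(2) by auto

lemma many_one_reducible_refl: "many_one_reducible P P"
  by (rule many_one_reducible_total[where F = "\<lambda>n. n"]) (auto intro: recursive_proj)

section \<open>Specifications of arithmetical truth\<close>

abbreviation "zerosF \<equiv> Fun 2 [] StreamSort"
abbreviation "onesF \<equiv> Fun 3 [] StreamSort"
abbreviation "argF \<equiv> Fun 4 [] StreamSort"
abbreviation "numF \<equiv> Fun 5 [] StreamSort"
abbreviation "headF \<equiv> Fun 6 [StreamSort] BitSort"
abbreviation "tailF \<equiv> Fun 7 [StreamSort] StreamSort"
abbreviation "isnatF \<equiv> Fun 8 [StreamSort] BitSort"
abbreviation "uniF \<equiv> Fun 9 [StreamSort] StreamSort"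
abbreviation "exF \<equiv> Fun 10 [StreamSort] StreamSort"
abbreviation "eqF \<equiv> Fun 11 [StreamSort, StreamSort] BitSort"
abbreviation "nthF \<equiv> Fun 12 [StreamSort, StreamSort] BitSort"
abbreviation "addF \<equiv> Fun 13 [StreamSort, StreamSort] StreamSort"
abbreviation "mulF \<equiv> Fun 14 [StreamSort, StreamSort] StreamSort"
abbreviation "ifbF \<equiv> Fun 15 [BitSort, BitSort, BitSort] BitSort"
abbreviation "ifsF \<equiv> Fun 16 [BitSort, StreamSort, StreamSort] StreamSort"
text \<open>The name encodes the whole formula, so that an interpretation can recover it by
  \<open>from_nat\<close>. The offset 17 keeps clear of the fixed names; truth and witness symbols
  share a name and differ in their result sort.\<close>

abbreviation "truthF K \<phi> \<equiv> Fun (17 + to_nat \<phi>) (replicate K StreamSort) BitSort"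
abbreviation "witnessF K \<phi> \<equiv> Fun (17 + to_nat \<phi>) (replicate K StreamSort) StreamSort"

abbreviation "SV x \<equiv> Var x StreamSort"
abbreviation "BV x \<equiv> Var x BitSort"
abbreviation "T0 \<equiv> App Zero []"
abbreviation "T1 \<equiv> App One []"
abbreviation "ConsT a b \<equiv> App Cons [a, b]"
abbreviation "zerosT \<equiv> App zerosF []"
abbreviation "addT a b \<equiv> App addF [a, b]"
abbreviation "mulT a b \<equiv> App mulF [a, b]"
abbreviation "eqT a b \<equiv> App eqF [a, b]"
abbreviation "nthT a b \<equiv> App nthF [a, b]"
abbreviation "isnatT a \<equiv> App isnatF [a]"
abbreviation "notT a \<equiv> App ifbF [a, T0, T1]"
abbreviation "andT a b \<equiv> App ifbF [a, b, T0]"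
abbreviation "impT a b \<equiv> App ifbF [a, b, T1]"
abbreviation "ppT a b \<equiv> addT (mulT (addT a b) (addT a b)) a"

text \<open>
  The number \<open>n\<close> is represented by the stream of \<open>n\<close> ones followed by zeros. The equations for
  \<open>ifsF\<close> force \<open>eqF\<close> to be equality, so that every quantifier-free condition becomes an equation.
  The equation for \<open>onesF\<close> excludes the only nonstandard stream that the other equations for
  \<open>isnatF\<close> leave open. The last equation ensures that \<open>uniF\<close> is the function whose graph is
  represented by the stream \<open>argF\<close>, if \<open>argF\<close> represents one.
\<close>

definition base_eqs :: "(trm \<times> trm) list" where
  "base_eqs = [
     (zerosT, ConsT T0 zerosT),
     (App onesF [], ConsT T1 (App onesF [])),
     (ConsT (App headF [SV 0]) (App tailF [SV 0]), SV 0),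
     (App ifbF [T1, BV 0, BV 1], BV 0),
     (App ifbF [T0, BV 0, BV 1], BV 1),
     (App ifsF [T1, SV 0, SV 1], SV 0),
     (App ifsF [T0, SV 0, SV 1], SV 1),
     (eqT (SV 0) (SV 0), T1),
     (App ifsF [eqT (SV 0) (SV 1), SV 0, SV 1], SV 1),
     (isnatT (ConsT T1 (SV 0)), isnatT (SV 0)),
     (isnatT (ConsT T0 (SV 0)), eqT (SV 0) zerosT),
     (isnatT (App onesF []), T0),
     (nthT (SV 0) zerosT, App headF [SV 0]),
     (nthT (SV 0) (ConsT T1 (SV 1)), nthT (App tailF [SV 0]) (SV 1)),
     (addT (SV 0) zerosT, SV 0),
     (addT (SV 0) (ConsT T1 (SV 1)), ConsT T1 (addT (SV 0) (SV 1))),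
     (mulT (SV 0) zerosT, zerosT),
     (mulT (SV 0) (ConsT T1 (SV 1)), addT (mulT (SV 0) (SV 1)) (SV 0)),
     (impT (isnatT (SV 0)) (isnatT (App uniF [SV 0])), T1),
     (impT (isnatT (SV 0)) (isnatT (App exF [SV 0])), T1),
     (impT (isnatT (SV 0)) (impT (isnatT (SV 1))
        (impT (nthT (App argF []) (ppT (SV 0) (SV 1)))
          (nthT (App argF []) (ppT (SV 0) (App uniF [SV 0]))))), T1)]"

instance nterm :: countable by countable_datatype
instance arith_form :: countable by countable_datatype

fun nbound :: "nterm \<Rightarrow> nat" where
  "nbound (NVar x) = Suc x"
| "nbound NZero = 0"
| "nbound (NSuc a) = nbound a"
| "nbound (NAdd a b) = max (nbound a) (nbound b)"
| "nbound (NMul a b) = max (nbound a) (nbound b)"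
| "nbound (NApp i a) = nbound a"

fun fbound :: "arith_form \<Rightarrow> nat" where
  "fbound (Eq a b) = max (nbound a) (nbound b)"
| "fbound (Neg \<phi>) = fbound \<phi>"
| "fbound (Conj \<phi> \<psi>) = max (fbound \<phi>) (fbound \<psi>)"
| "fbound (All x \<phi>) = max (Suc x) (fbound \<phi>)"

text \<open>\<open>Pi12\<close> fixes all function variables other than 0 and 1 to zero, which the
  last clause mirrors.\<close>

fun ntrm :: "nterm \<Rightarrow> trm" where
  "ntrm (NVar x) = SV x"
| "ntrm NZero = zerosT"
| "ntrm (NSuc a) = ConsT T1 (ntrm a)"
| "ntrm (NAdd a b) = addT (ntrm a) (ntrm b)"
| "ntrm (NMul a b) = mulT (ntrm a) (ntrm b)"
| "ntrm (NApp i a) = (if i = 0 then App uniF [ntrm a] else if i = 1 then App exF [ntrm a] else zerosT)"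

text \<open>A quantified formula receives all \<open>K\<close> variables as arguments, the bound
  ones included. This gives all truth symbols the same argument list and avoids the computation of
  free variables.\<close>

fun ftrm :: "nat \<Rightarrow> arith_form \<Rightarrow> trm" where
  "ftrm K (Eq a b) = eqT (ntrm a) (ntrm b)"
| "ftrm K (Neg \<phi>) = notT (ftrm K \<phi>)"
| "ftrm K (Conj \<phi> \<psi>) = andT (ftrm K \<phi>) (ftrm K \<psi>)"
| "ftrm K (All x \<phi>) = App (truthF K (All x \<phi>)) (map SV [0..<K])"

text \<open>
  The universally quantified \<open>x\<close> keeps its own name in the translation of the body; its outer value,
  which the symbols for the quantified formula receive as an argument, is held by the fresh variable
  \<open>K\<close>. No substitution is needed for the witness either: the premise of the second equation makes
  \<open>x\<close> equal to it.
\<close>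

fun truth_eqs :: "nat \<Rightarrow> arith_form \<Rightarrow> (trm \<times> trm) list" where
  "truth_eqs K (Eq a b) = []"
| "truth_eqs K (Neg \<phi>) = truth_eqs K \<phi>"
| "truth_eqs K (Conj \<phi> \<psi>) = truth_eqs K \<phi> @ truth_eqs K \<psi>"
| "truth_eqs K (All x \<phi>) =
    (let xs = map SV ([0..<K][x := K]); \<psi> = All x \<phi> in
     [(impT (App (truthF K \<psi>) xs) (impT (isnatT (SV x)) (ftrm K \<phi>)), T1),
      (impT (eqT (SV x) (App (witnessF K \<psi>) xs))
        (impT (notT (App (truthF K \<psi>) xs)) (andT (isnatT (SV x)) (notT (ftrm K \<phi>)))), T1)])
    @ truth_eqs K \<phi>"

text \<open>Replaces substitution into the formula: the equation is made conditional on the initial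
  values prescribed in \<open>Pi12\<close>, the input at variable 0 and zero at the others.\<close>

fun guarded :: "nat list \<Rightarrow> trm \<Rightarrow> trm" where
  "guarded [] t = t"
| "guarded (i # js) t = impT (eqT (SV i) (if i = 0 then App numF [] else zerosT)) (guarded js t)"

definition root_eq :: "nat \<Rightarrow> arith_form \<Rightarrow> trm \<times> trm" where
  "root_eq K \<phi> = (guarded [0..<K] (ftrm K \<phi>), T1)"

fun numeral_trm :: "nat \<Rightarrow> trm" where
  "numeral_trm 0 = zerosT"
| "numeral_trm (Suc n) = ConsT T1 (numeral_trm n)"

fun syms :: "trm \<Rightarrow> symbol list" where
  "syms (Var x s) = []"
| "syms (App f ts) = f # concat (map syms ts)"

text \<open>Sorting can be checked in the signature of all symbols and then restricted to those that
  occur.\<close>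

lemma has_sort_syms:
  "has_sort UNIV t s \<Longrightarrow> set (syms t) \<subseteq> \<Sigma> \<Longrightarrow> has_sort \<Sigma> t s"
proof (induction t arbitrary: s)
  case (App f ts)
  have "list_all2 (has_sort \<Sigma>) ts (arg_sorts f)"
    by (rule list.rel_mono_strong[of "has_sort UNIV"]) (use App in auto)
  with App.prems show ?case by simp
qed simp

lemma has_sort_ntrm: "has_sort UNIV (ntrm a) StreamSort"
  by (induction a) auto

lemma has_sort_vars [simp]:
  "length js = K \<Longrightarrow> list_all2 (has_sort UNIV) (map SV js) (replicate K StreamSort)"
  by (simp add: list_all2_conv_all_nth)

lemma has_sort_ftrm: "has_sort UNIV (ftrm K \<phi>) BitSort"
  by (induction \<phi>) (auto simp: has_sort_ntrm)

lemma eval_nterm_cong: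
  "(\<And>i. i < nbound a \<Longrightarrow> e i = e' i) \<Longrightarrow> eval_nterm F e a = eval_nterm F e' a"
  by (induction a) auto

lemma holds_cong:
  "(\<And>i. i < fbound \<phi> \<Longrightarrow> e i = e' i) \<Longrightarrow> holds F e \<phi> \<longleftrightarrow> holds F e' \<phi>"
proof (induction \<phi> arbitrary: e e')
  case (Eq a b)
  have "eval_nterm F e a = eval_nterm F e' a" "eval_nterm F e b = eval_nterm F e' b"
    by (rule eval_nterm_cong; use Eq in simp)+
  then show ?case by simp
next
  case (Conj \<phi> \<psi>)
  have "holds F e \<phi> \<longleftrightarrow> holds F e' \<phi>" "holds F e \<psi> \<longleftrightarrow> holds F e' \<psi>"
    by (rule Conj.IH; use Conj.prems in simp)+
  then show ?case by simp
next
  case (All x \<phi>)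
  have "holds F (e(x := n)) \<phi> \<longleftrightarrow> holds F (e'(x := n)) \<phi>" for n
    by (rule All.IH) (use All.prems in auto)
  then show ?case by simp
next
  case (Neg \<phi>)
  have "holds F e \<phi> \<longleftrightarrow> holds F e' \<phi>"
    by (rule Neg.IH) (use Neg.prems in simp)
  then show ?case by simp
qed

section \<open>Numbers as streams\<close>

definition num :: "nat \<Rightarrow> nat \<Rightarrow> bool" where
  "num n k \<longleftrightarrow> k < n"

lemma num_Suc: "num (Suc n) = case_nat True (num n)"
  by (auto simp: num_def fun_eq_iff split: nat.split)

lemma num_0: "num 0 = (\<lambda>_. False)"
  by (simp add: num_def fun_eq_iff)

lemma num_eq_iff [simp]: "num m = num n \<longleftrightarrow> m = n"
proof
  assume eq: "num m = num n"
  then have "num m m = num n m" "num m n = num n n" by simp_all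
  then show "m = n" by (simp add: num_def)
qed simp

lemma inv_num [simp]: "inv num (num n) = n"
  by (rule inv_f_f) (simp add: inj_def)

lemma case_nat_stream: "case_nat (x 0) (x \<circ> Suc) = (x :: nat \<Rightarrow> bool)"
  by (auto simp: fun_eq_iff split: nat.split)

lemma case_nat_eq_iff: "case_nat b x = (y :: nat \<Rightarrow> bool) \<longleftrightarrow> y 0 = b \<and> y \<circ> Suc = x"
  by (auto simp: fun_eq_iff split: nat.split)

lemma num_neq_ones: "num n \<noteq> (\<lambda>_. True)"
  by (auto simp: num_def fun_eq_iff)

text \<open>This is where positions being standard enters: any other stream has a zero at a genuine
  natural number, so leading ones can be removed by ordinary induction.\<close>

lemma stream_cases:
  obtains (all_True) "x = (\<lambda>_. True)" | (prefix) n y where "x = ((case_nat True) ^^ n) (case_nat False y)"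
proof (cases "\<exists>n. \<not> x n")
  case True
  then obtain n where "\<not> x n" by blast
  then have "\<exists>n y. x = ((case_nat True) ^^ n) (case_nat False y)"
  proof (induction n arbitrary: x)
    case 0
    then have "x = ((case_nat True) ^^ 0) (case_nat False (x \<circ> Suc))"
      using case_nat_stream[of x] by simp
    then show ?case by blast
  next
    case (Suc n)
    then obtain m y where *: "x \<circ> Suc = ((case_nat True) ^^ m) (case_nat False y)"
      by (metis comp_apply)
    show ?case
    proof (cases "x 0")
      case True
      with * have "x = ((case_nat True) ^^ Suc m) (case_nat False y)"
        using case_nat_stream[of x] by simp
      then show ?thesis by blast
    next
      case False
      then have "x = ((case_nat True) ^^ 0) (case_nat False (x \<circ> Suc))"
        using case_nat_stream[of x] by simp
      then show ?thesis by blast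
    qed
  qed
  then show ?thesis using prefix by blast
qed (use all_True in auto)

section \<open>Arithmetic in an arbitrary model\<close>

definition env :: "(nat \<Rightarrow> nat \<Rightarrow> bool) \<Rightarrow> (nat \<Rightarrow> bool) \<Rightarrow> nat \<Rightarrow> srt \<Rightarrow> val" where
  "env X b x s = (case s of BitSort \<Rightarrow> BitVal (b x) | StreamSort \<Rightarrow> StreamVal (X x))"

lemma env_simps [simp]: "env X b x BitSort = BitVal (b x)" "env X b x StreamSort = StreamVal (X x)"
  by (simp_all add: env_def)

lemma env_exhaust:
  assumes "\<And>x s. \<alpha> x s \<in> carrier AS s"
  obtains X b where "\<alpha> = env X b" "\<And>x. X x \<in> AS"
proof -
  have "\<exists>b. \<forall>x. \<alpha> x BitSort = BitVal (b x)" "\<exists>X. \<forall>x. X x \<in> AS \<and> \<alpha> x StreamSort = StreamVal (X x)"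
    using assms[of _ BitSort] assms[of _ StreamSort] by (auto intro!: choice simp: image_iff) 
  then obtain b X where "\<forall>x. \<alpha> x BitSort = BitVal (b x)" "\<forall>x. X x \<in> AS \<and> \<alpha> x StreamSort = StreamVal (X x)"
    by blast
  then show ?thesis by (intro that[of X b]) (auto simp: fun_eq_iff env_def split: srt.split)
qed

lemma env_in_carrier: "(\<And>x. X x \<in> AS) \<Longrightarrow> env X b x s \<in> carrier AS s"
  by (cases s) auto

text \<open>\<open>E\<close> is a parameter because the locale is used twice: for any model of a
  full specification, and for the standard model before its root equation has been verified.\<close>

locale truth_model =
  fixes \<Sigma> AS I E
  assumes alg: "stream_algebra \<Sigma> AS I" and mod: "models AS I (set E)"
    and base: "set base_eqs \<subseteq> set E"
    and syms: "\<And>l r. (l, r) \<in> set E \<Longrightarrow> set (syms l) \<union> set (syms r) \<subseteq> \<Sigma>"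
    and sig: "{Zero, One, Cons, zerosF, onesF, argF, numF, headF, tailF, isnatF, uniF, exF, eqF, nthF,
      addF, mulF, ifbF, ifsF} \<subseteq> \<Sigma>"
begin

lemma env_eq:
  "(l, r) \<in> set E \<Longrightarrow> (\<And>i. X i \<in> AS) \<Longrightarrow> eval_trm I (env X b) l = eval_trm I (env X b) r"
  by (rule modelsD[OF mod _ env_in_carrier])

lemma base_eq:
  "(l, r) \<in> set base_eqs \<Longrightarrow> (\<And>i. X i \<in> AS) \<Longrightarrow> eval_trm I (env X b) l = eval_trm I (env X b) r"
  using env_eq base by blast

lemma bit_consts [simp]: "I Zero [] = BitVal False" "I One [] = BitVal True"
  using alg by (simp_all add: stream_algebra_def)

lemma cons_closed: "x \<in> AS \<Longrightarrow> case_nat b x \<in> AS"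
  using stream_algebra_closed[OF alg, of Cons "[BitVal b, StreamVal x]"]
    stream_algebra_Cons[OF alg, of x b] sig by auto

lemma cons_value [simp]: "x \<in> AS \<Longrightarrow> I Cons [BitVal b, StreamVal x] = StreamVal (case_nat b x)"
  by (rule stream_algebra_Cons[OF alg])

lemma stream_value:
  assumes "Fun i ss StreamSort \<in> \<Sigma>" "list_all2 (\<lambda>v s. v \<in> carrier AS s) vs ss"
  obtains x where "I (Fun i ss StreamSort) vs = StreamVal x" "x \<in> AS"
  using stream_algebra_closed[OF alg assms(1)] assms(2) by auto

lemma bit_value:
  assumes "Fun i ss BitSort \<in> \<Sigma>" "list_all2 (\<lambda>v s. v \<in> carrier AS s) vs ss"
  obtains b where "I (Fun i ss BitSort) vs = BitVal b"
  using stream_algebra_closed[OF alg assms(1)] assms(2) by auto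

lemma zeros: "I zerosF [] = StreamVal (num 0)" and num_0_closed: "num 0 \<in> AS"
proof -
  obtain z where z: "I zerosF [] = StreamVal z" "z \<in> AS"
    using stream_value[of 2 "[]" "[]"] sig by auto
  then have eq: "z = case_nat False z"
    using base_eq[of zerosT "ConsT T0 zerosT" "\<lambda>_. z"] by (simp add: base_eqs_def)
  have "z k = num 0 k" for k
  proof (induction k)
    case 0
    show ?case using fun_cong[OF eq, of 0] by (simp add: num_0)
  next
    case (Suc k)
    then show ?case using fun_cong[OF eq, of "Suc k"] by (simp add: num_0)
  qed
  then have "z = num 0" by blast
  with z show "I zerosF [] = StreamVal (num 0)" "num 0 \<in> AS" by simp_all
qed

lemma num_closed: "num n \<in> AS"
  by (induction n) (auto simp: num_0_closed num_Suc intro: cons_closed)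

lemma ones: "I onesF [] = StreamVal (\<lambda>_. True)"
proof -
  obtain z where z: "I onesF [] = StreamVal z" "z \<in> AS"
    using stream_value[of 3 "[]" "[]"] sig by auto
  then have eq: "z = case_nat True z"
    using base_eq[of "App onesF []" "ConsT T1 (App onesF [])" "\<lambda>_. z"] by (simp add: base_eqs_def)
  have "z k = True" for k
  proof (induction k)
    case 0
    show ?case using fun_cong[OF eq, of 0] by simp
  next
    case (Suc k)
    then show ?case using fun_cong[OF eq, of "Suc k"] by simp
  qed
  then have "z = (\<lambda>_. True)" by blast
  with z show ?thesis by simp
qed

lemma head [simp]: "x \<in> AS \<Longrightarrow> I headF [StreamVal x] = BitVal (x 0)"
  and tail [simp]: "x \<in> AS \<Longrightarrow> I tailF [StreamVal x] = StreamVal (x \<circ> Suc)"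
  and tail_closed: "x \<in> AS \<Longrightarrow> x \<circ> Suc \<in> AS"
proof -
  assume x: "x \<in> AS"
  obtain y where y: "I tailF [StreamVal x] = StreamVal y" "y \<in> AS"
    using stream_value[of 7 "[StreamSort]" "[StreamVal x]"] sig x by auto
  obtain b where b: "I headF [StreamVal x] = BitVal b"
    using bit_value[of 6 "[StreamSort]" "[StreamVal x]"] sig x by auto
  have "case_nat b y = x"
    using base_eq[of "ConsT (App headF [SV 0]) (App tailF [SV 0])" "SV 0" "\<lambda>_. x"] x y b
    by (simp add: base_eqs_def)
  then have "b = x 0" "y = x \<circ> Suc" by (auto simp: case_nat_eq_iff)
  with y b show "I headF [StreamVal x] = BitVal (x 0)"
    "I tailF [StreamVal x] = StreamVal (x \<circ> Suc)" "x \<circ> Suc \<in> AS" by simp_all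
qed

lemma ifb [simp]: "I ifbF [BitVal a, BitVal b, BitVal c] = BitVal (if a then b else c)"
proof -
  have "I ifbF [BitVal True, BitVal b, BitVal c] = BitVal b"
    using base_eq[of "App ifbF [T1, BV 0, BV 1]" "BV 0" "\<lambda>_. num 0" "\<lambda>i. if i = 0 then b else c"]
    by (simp add: base_eqs_def num_closed)
  moreover have "I ifbF [BitVal False, BitVal b, BitVal c] = BitVal c"
    using base_eq[of "App ifbF [T0, BV 0, BV 1]" "BV 1" "\<lambda>_. num 0" "\<lambda>i. if i = 0 then b else c"]
    by (simp add: base_eqs_def num_closed)
  ultimately show ?thesis by simp
qed

text \<open>If \<open>eqF\<close> yields 1 at \<open>x\<close> and \<open>y\<close>, one
  \<open>ifsF\<close> equation gives the conditional the value \<open>y\<close> and the other the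
  value \<open>x\<close>. The converse is the reflexivity equation.\<close>

lemma eq [simp]:
  assumes "x \<in> AS" "y \<in> AS"
  shows "I eqF [StreamVal x, StreamVal y] = BitVal (x = y)"
proof -
  let ?X = "\<lambda>i. if i = 0 then x else y"
  obtain b where b: "I eqF [StreamVal x, StreamVal y] = BitVal b"
    using bit_value[of 11 "[StreamSort, StreamSort]" "[StreamVal x, StreamVal y]"] sig assms by auto
  have "I ifsF [BitVal b, StreamVal x, StreamVal y] = StreamVal y"
    using base_eq[of "App ifsF [eqT (SV 0) (SV 1), SV 0, SV 1]" "SV 1" ?X] assms b
    by (simp add: base_eqs_def)
  moreover have "I ifsF [BitVal True, StreamVal x, StreamVal y] = StreamVal x"
    using base_eq[of "App ifsF [T1, SV 0, SV 1]" "SV 0" ?X] assms by (simp add: base_eqs_def)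
  moreover have "I eqF [StreamVal x, StreamVal x] = BitVal True"
    using base_eq[of "eqT (SV 0) (SV 0)" T1 "\<lambda>_. x"] assms by (simp add: base_eqs_def)
  ultimately show ?thesis using b by (cases b) auto
qed

text \<open>Leading ones are stripped by one equation; at the first zero another reduces the
  question to equality with the zero stream, which \<open>eqF\<close> decides. Only the stream of
  ones escapes this induction.\<close>

lemma isnat [simp]:
  assumes "x \<in> AS"
  shows "I isnatF [StreamVal x] = BitVal (\<exists>n. x = num n)"
proof (cases x rule: stream_cases)
  case all_True
  have "I isnatF [StreamVal (\<lambda>_. True)] = BitVal False"
    using base_eq[of "isnatT (App onesF [])" T0 "\<lambda>_. num 0"]
    by (simp add: base_eqs_def num_closed ones)
  with all_True show ?thesis by (simp add: num_neq_ones[symmetric])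
next
  case (prefix n y)
  then show ?thesis using assms
  proof (induction n arbitrary: x)
    case 0
    then have y: "y \<in> AS" using tail_closed[of x] by (simp add: comp_def)
    have "(\<exists>n. x = num n) \<longleftrightarrow> y = num 0"
    proof
      assume "\<exists>n. x = num n"
      then obtain n where "x = num n" by blast
      with 0 have "n = 0" by (cases n) (auto simp: num_Suc dest: fun_cong[of _ _ 0])
      with 0 \<open>x = num n\<close> show "y = num 0" by (auto simp: num_0 fun_eq_iff split: nat.splits)
    next
      assume "y = num 0"
      with 0 have "x = num 0" by (auto simp: num_0 fun_eq_iff split: nat.split)
      then show "\<exists>n. x = num n" by blast
    qed
    moreover have "I isnatF [StreamVal (case_nat False y)] = BitVal (y = num 0)"
      using base_eq[of "isnatT (ConsT T0 (SV 0))" "eqT (SV 0) zerosT" "\<lambda>_. y"] y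
      by (simp add: base_eqs_def zeros num_closed)
    ultimately show ?case using 0 by simp
  next
    case (Suc n)
    define z where "z = ((case_nat True) ^^ n) (case_nat False y)"
    have x: "x = case_nat True z" using Suc.prems by (simp add: z_def)
    have z: "z \<in> AS" using tail_closed[OF Suc.prems(2)] x by (simp add: comp_def)
    have "(\<exists>n. x = num n) \<longleftrightarrow> (\<exists>n. z = num n)"
    proof
      assume "\<exists>n. x = num n"
      then obtain n where n: "x = num n" by blast
      with x obtain m where "n = Suc m" by (cases n) (auto simp: num_0 dest: fun_cong[of _ _ 0])
      with n x have "z = num m" by (simp add: num_Suc case_nat_eq_iff) (simp add: comp_def)
      then show "\<exists>n. z = num n" by blast
    next
      assume "\<exists>n. z = num n"
      then show "\<exists>n. x = num n" using x num_Suc by metis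
    qed
    moreover have "I isnatF [StreamVal (case_nat True z)] = I isnatF [StreamVal z]"
      using base_eq[of "isnatT (ConsT T1 (SV 0))" "isnatT (SV 0)" "\<lambda>_. z"] z
      by (simp add: base_eqs_def)
    ultimately show ?case using Suc.IH[OF z_def z] x by simp
  qed
qed

lemma nth: "x \<in> AS \<Longrightarrow> I nthF [StreamVal x, StreamVal (num n)] = BitVal (x n)"
proof (induction n arbitrary: x)
  case 0
  then show ?case
    using base_eq[of "nthT (SV 0) zerosT" "App headF [SV 0]" "\<lambda>_. x"] by (simp add: base_eqs_def zeros)
next
  case (Suc n)
  let ?X = "\<lambda>i. if i = 0 then x else num n"
  have "I nthF [StreamVal x, StreamVal (num (Suc n))] = I nthF [StreamVal (x \<circ> Suc), StreamVal (num n)]"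
    using base_eq[of "nthT (SV 0) (ConsT T1 (SV 1))" "nthT (App tailF [SV 0]) (SV 1)" ?X] Suc.prems
    by (simp add: base_eqs_def num_closed num_Suc)
  also have "\<dots> = BitVal ((x \<circ> Suc) n)"
    by (rule Suc.IH[OF tail_closed[OF Suc.prems]])
  finally show ?case by simp
qed

lemma add: "I addF [StreamVal (num m), StreamVal (num n)] = StreamVal (num (m + n))"
proof (induction n)
  case 0
  then show ?case
    using base_eq[of "addT (SV 0) zerosT" "SV 0" "\<lambda>_. num m"] by (simp add: base_eqs_def zeros num_closed)
next
  case (Suc n)
  then show ?case
    using base_eq[of "addT (SV 0) (ConsT T1 (SV 1))" "ConsT T1 (addT (SV 0) (SV 1))"
        "\<lambda>i. if i = 0 then num m else num n"]
    by (simp add: base_eqs_def num_closed num_Suc)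
qed

lemma mul: "I mulF [StreamVal (num m), StreamVal (num n)] = StreamVal (num (m * n))"
proof (induction n)
  case 0
  then show ?case
    using base_eq[of "mulT (SV 0) zerosT" zerosT "\<lambda>_. num m"] by (simp add: base_eqs_def zeros num_closed)
next
  case (Suc n)
  then show ?case
    using base_eq[of "mulT (SV 0) (ConsT T1 (SV 1))" "addT (mulT (SV 0) (SV 1)) (SV 0)"
        "\<lambda>i. if i = 0 then num m else num n"]
    by (simp add: base_eqs_def num_closed num_Suc add add.commute)
qed

lemma uni: "\<exists>F. \<forall>n. I uniF [StreamVal (num n)] = StreamVal (num (F n))"
proof -
  have "\<exists>m. I uniF [StreamVal (num n)] = StreamVal (num m)" for n
  proof -
    obtain y where y: "I uniF [StreamVal (num n)] = StreamVal y" "y \<in> AS"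
      using stream_value[of 9 "[StreamSort]" "[StreamVal (num n)]"] sig num_closed by auto
    then show ?thesis
      using base_eq[of "impT (isnatT (SV 0)) (isnatT (App uniF [SV 0]))" T1 "\<lambda>_. num n"]
      by (simp add: base_eqs_def num_closed)
  qed
  then show ?thesis by metis
qed

lemma ex: "\<exists>F. \<forall>n. I exF [StreamVal (num n)] = StreamVal (num (F n))"
proof -
  have "\<exists>m. I exF [StreamVal (num n)] = StreamVal (num m)" for n
  proof -
    obtain y where y: "I exF [StreamVal (num n)] = StreamVal y" "y \<in> AS"
      using stream_value[of 10 "[StreamSort]" "[StreamVal (num n)]"] sig num_closed by auto
    then show ?thesis
      using base_eq[of "impT (isnatT (SV 0)) (isnatT (App exF [SV 0]))" T1 "\<lambda>_. num n"]
      by (simp add: base_eqs_def num_closed)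
  qed
  then show ?thesis by metis
qed

lemma arg_graph:
  assumes "I argF [] = StreamVal \<sigma>" "\<And>n. I uniF [StreamVal (num n)] = StreamVal (num (F n))"
    and "\<sigma> (pp x y)"
  shows "\<sigma> (pp x (F x))"
proof -
  have "\<sigma> \<in> AS" using stream_value[of 4 "[]" "[]"] sig assms(1) by auto
  then show ?thesis using assms
      base_eq[of "impT (isnatT (SV 0)) (impT (isnatT (SV 1))
        (impT (nthT (App argF []) (ppT (SV 0) (SV 1)))
          (nthT (App argF []) (ppT (SV 0) (App uniF [SV 0])))))" T1
        "\<lambda>i. if i = 0 then num x else num y"]
    by (simp add: base_eqs_def num_closed nth add mul pp_def)
qed

lemma numeral_eval: "eval_trm I \<alpha> (numeral_trm n) = StreamVal (num n)"
  by (induction n) (simp_all add: zeros num_closed num_Suc)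

lemma guarded_eval:
  assumes "I numF [] = StreamVal (num n)" "\<And>i. X i \<in> AS" "eval_trm I (env X b) t = BitVal c"
  shows "eval_trm I (env X b) (guarded js t) =
    BitVal ((\<forall>i \<in> set js. X i = num (if i = 0 then n else 0)) \<longrightarrow> c)"
  using assms by (induction js) (auto simp: zeros num_closed)

context
  fixes F :: "nat \<Rightarrow> nat \<Rightarrow> nat"
  assumes F: "\<And>n. I uniF [StreamVal (num n)] = StreamVal (num (F 0 n))"
    "\<And>n. I exF [StreamVal (num n)] = StreamVal (num (F 1 n))"
    "\<forall>i \<ge> 2. \<forall>n. F i n = 0"
begin

lemma ntrm_eval:
  "eval_trm I (env (\<lambda>i. num (e i)) b) (ntrm a) = StreamVal (num (eval_nterm F e a))"
  by (induction a) (simp_all add: zeros num_closed num_Suc add mul F)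

text \<open>For a quantified formula, the first equation at each number gives one implication, and
  the second equation at the value of the witness symbol gives the other.\<close>

lemma ftrm_eval:
  assumes "fbound \<phi> \<le> K" "set (truth_eqs K \<phi>) \<subseteq> set E"
  shows "eval_trm I (env (\<lambda>i. num (e i)) b) (ftrm K \<phi>) = BitVal (holds F e \<phi>)"
  using assms
proof (induction \<phi> arbitrary: e)
  case (Eq a c)
  then show ?case by (simp add: ntrm_eval num_closed)
next
  case (All x \<phi>)
  define \<psi> where "\<psi> = All x \<phi>"
  define xs where "xs = map SV ([0..<K][x := K])"
  define vs where "vs = map (\<lambda>i. StreamVal (num (e i))) [0..<K]"
  \<comment> \<open>The outer value of \<open>x\<close> is kept at \<open>K\<close>, so the
    arguments \<open>xs\<close> evaluate to \<open>vs\<close> for every choice of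
    \<open>y\<close>.\<close>
  define X where "X y = (\<lambda>i. num (e i))(K := num (e x), x := y)" for y
  have x: "x < K" "fbound \<phi> \<le> K" using All.prems(1) by auto
  have in_E: "(impT (App (truthF K \<psi>) xs) (impT (isnatT (SV x)) (ftrm K \<phi>)), T1) \<in> set E"
    "(impT (eqT (SV x) (App (witnessF K \<psi>) xs))
        (impT (notT (App (truthF K \<psi>) xs)) (andT (isnatT (SV x)) (notT (ftrm K \<phi>)))), T1) \<in> set E"
    and IH_E: "set (truth_eqs K \<phi>) \<subseteq> set E"
    using All.prems(2) by (simp_all add: \<psi>_def xs_def Let_def)
  have \<Sigma>: "truthF K \<psi> \<in> \<Sigma>" "witnessF K \<psi> \<in> \<Sigma>" "set (syms (ftrm K \<phi>)) \<subseteq> \<Sigma>"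
    using syms[OF in_E(1)] syms[OF in_E(2)] by simp_all
  have X: "X y i \<in> AS" if "y \<in> AS" for y i using that by (simp add: X_def num_closed)
  have vs: "list_all2 (\<lambda>v s. v \<in> carrier AS s) vs (replicate K StreamSort)"
    by (simp add: vs_def list_all2_conv_all_nth num_closed)
  have xs: "map (eval_trm I (env (X y) b)) xs = vs" for y
    using x by (intro nth_equalityI) (auto simp: xs_def vs_def X_def nth_list_update)
  obtain t where t: "I (truthF K \<psi>) vs = BitVal t" using bit_value[OF \<Sigma>(1) vs] .
  obtain w where w: "I (witnessF K \<psi>) vs = StreamVal w" "w \<in> AS" using stream_value[OF \<Sigma>(2) vs] .
  have IH: "eval_trm I (env (X (num m)) b) (ftrm K \<phi>) = BitVal (holds F (e(x := m)) \<phi>)" for m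
  proof -
    have "X (num m) = (\<lambda>i. num ((e(K := e x, x := m)) i))" by (auto simp: X_def)
    then have "eval_trm I (env (X (num m)) b) (ftrm K \<phi>) = BitVal (holds F (e(K := e x, x := m)) \<phi>)"
      using All.IH[OF x(2) IH_E] by metis
    also have "holds F (e(K := e x, x := m)) \<phi> \<longleftrightarrow> holds F (e(x := m)) \<phi>"
      by (rule holds_cong) (use x in auto)
    finally show ?thesis .
  qed
  have "holds F (e(x := m)) \<phi>" if t for m
    using env_eq[OF in_E(1), where X = "X (num m)" and b = b, OF X[OF num_closed]] t that
    by (simp add: xs IH) (simp add: X_def num_closed)
  moreover have "\<exists>m. \<not> holds F (e(x := m)) \<phi>" if "\<not> t"
  proof -
    \<comment> \<open>The witness \<open>w\<close> is not yet known to be a number, so the induction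
      hypothesis does not apply. Sorting alone gives the body some bit value, and the equation then
      forces \<open>w\<close> to be a number.\<close>
    have "eval_trm I (env (X w) b) (ftrm K \<phi>) \<in> carrier AS BitSort"
      by (rule eval_trm_in_carrier[OF alg has_sort_syms[OF has_sort_ftrm \<Sigma>(3)]])
        (intro env_in_carrier X w)
    then obtain c where c: "eval_trm I (env (X w) b) (ftrm K \<phi>) = BitVal c" by auto
    have "X w x = w" by (simp add: X_def)
    then have "(\<exists>m. w = num m) \<and> \<not> c"
      using env_eq[OF in_E(2), where X = "X w" and b = b, OF X[OF w(2)]] t that w
      by (simp add: xs c split: if_splits)
    with c IH show ?thesis by auto
  qed
  moreover have "map (eval_trm I (env (\<lambda>i. num (e i)) b)) (map SV [0..<K]) = vs" by (simp add: vs_def)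
  ultimately have "eval_trm I (env (\<lambda>i. num (e i)) b) (ftrm K \<psi>) = BitVal t"
    and "holds F e \<psi> \<longleftrightarrow> t"
    using t unfolding \<psi>_def ftrm.simps eval_trm.simps by (metis, auto)
  then show ?case by (simp only: \<psi>_def)
qed simp_all

lemma root_sound:
  assumes "I numF [] = StreamVal (num n)" "fbound \<phi> \<le> K" "set (truth_eqs K \<phi>) \<subseteq> set E"
    and "root_eq K \<phi> \<in> set E"
  shows "holds F ((\<lambda>_. 0)(0 := n)) \<phi>"
proof -
  let ?X = "\<lambda>i. num (((\<lambda>_. 0)(0 := n)) i)" and ?b = "\<lambda>_. False"
  have X: "?X i \<in> AS" for i by (simp add: num_closed)
  have "eval_trm I (env ?X ?b) (guarded [0..<K] (ftrm K \<phi>)) =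
      BitVal ((\<forall>i \<in> set [0..<K]. ?X i = num (if i = 0 then n else 0)) \<longrightarrow> holds F ((\<lambda>_. 0)(0 := n)) \<phi>)"
    by (rule guarded_eval[OF assms(1) X ftrm_eval[OF assms(2,3), of "(\<lambda>_. 0)(0 := n)"]])
  moreover have "eval_trm I (env ?X ?b) (guarded [0..<K] (ftrm K \<phi>)) = BitVal True"
    using env_eq[OF assms(4)[unfolded root_eq_def], where X = ?X and b = ?b, OF X] by simp
  ultimately show ?thesis by simp
qed

end

end

section \<open>The specification attached to a formula and an input\<close>

definition spec_eqs :: "nat \<Rightarrow> arith_form \<Rightarrow> nat \<Rightarrow> (trm \<times> trm) list" where
  "spec_eqs K \<phi> n =
    (App numF [], numeral_trm n) # base_eqs @ truth_eqs K \<phi> @ [root_eq K \<phi>]"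

text \<open>The signature is independent of \<open>n\<close>, as numerals use only symbols of
  \<open>base_eqs\<close>. The input thus affects a single equation of the coded instance.\<close>

definition spec_syms :: "nat \<Rightarrow> arith_form \<Rightarrow> symbol list" where
  "spec_syms K \<phi> = [Zero, One, Cons, numF] @
     concat (map (\<lambda>(l, r). syms l @ syms r) (base_eqs @ truth_eqs K \<phi> @ [root_eq K \<phi>]))"

definition truth_spec :: "nat \<Rightarrow> arith_form \<Rightarrow> nat \<Rightarrow> spec_term" where
  "truth_spec K \<phi> n = (spec_syms K \<phi>, spec_eqs K \<phi> n, App argF [])"

lemma has_sort_base_eqs: "\<forall>(l, r) \<in> set base_eqs. \<exists>s. has_sort UNIV l s \<and> has_sort UNIV r s"
  by (simp add: base_eqs_def)

lemma has_sort_truth_eqs: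
  "\<forall>(l, r) \<in> set (truth_eqs K \<phi>). \<exists>s. has_sort UNIV l s \<and> has_sort UNIV r s"
  by (induction \<phi>) (auto simp: Let_def has_sort_ftrm simp del: ftrm.simps)

lemma has_sort_guarded: "has_sort UNIV t BitSort \<Longrightarrow> has_sort UNIV (guarded js t) BitSort"
  by (induction js) auto

lemma has_sort_numeral_trm: "has_sort UNIV (numeral_trm n) StreamSort"
  by (induction n) auto

lemma syms_base_eqs:
  "{Zero, One, Cons, zerosF, onesF, argF, numF, headF, tailF, isnatF, uniF, exF, eqF, nthF,
      addF, mulF, ifbF, ifsF} \<subseteq> set (spec_syms K \<phi>)"
  unfolding spec_syms_def base_eqs_def by simp

lemma syms_numeral_trm: "set (syms (numeral_trm n)) \<subseteq> {One, Cons, zerosF}"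
  by (induction n) auto

lemma syms_spec_eqs:
  "(l, r) \<in> set (spec_eqs K \<phi> n) \<Longrightarrow> set (syms l) \<union> set (syms r) \<subseteq> set (spec_syms K \<phi>)"
proof -
  assume "(l, r) \<in> set (spec_eqs K \<phi> n)"
  then consider "l = App numF []" "r = numeral_trm n"
    | "(l, r) \<in> set (base_eqs @ truth_eqs K \<phi> @ [root_eq K \<phi>])"
    unfolding spec_eqs_def by auto
  then show ?thesis
  proof cases
    case 1
    then show ?thesis using syms_numeral_trm[of n] syms_base_eqs[of K \<phi>] by auto
  next
    case 2
    then show ?thesis unfolding spec_syms_def by (force simp del: append.simps)
  qed
qed

lemma valid_truth_spec: "valid_spec_term (truth_spec K \<phi> n)"
proof -
  have "\<exists>s. has_sort UNIV l s \<and> has_sort UNIV r s" if "(l, r) \<in> set (spec_eqs K \<phi> n)" for l r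
    using that has_sort_base_eqs has_sort_truth_eqs[of K \<phi>] has_sort_numeral_trm
      has_sort_guarded[OF has_sort_ftrm]
    by (fastforce simp: spec_eqs_def root_eq_def)
  then have "\<exists>s. has_sort (set (spec_syms K \<phi>)) l s \<and> has_sort (set (spec_syms K \<phi>)) r s"
    if "(l, r) \<in> set (spec_eqs K \<phi> n)" for l r
    using syms_spec_eqs[OF that] that by (metis has_sort_syms le_sup_iff)
  then show ?thesis
    using syms_base_eqs[of K \<phi>]
    by (auto simp: truth_spec_def bitstream_signature_def bitstream_spec_def)
qed

section \<open>The standard interpretation\<close>

type_synonym stream = "nat \<Rightarrow> bool"

text \<open>
  On streams that do not represent a number, addition and multiplication are set to the constant
  stream of ones, as the recursion equations have to hold for all streams.
\<close>

definition add_stream :: "stream \<Rightarrow> stream \<Rightarrow> stream" where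
  "add_stream x y = (if y \<in> range num then (case_nat True ^^ inv num y) x else (\<lambda>_. True))"

definition mul_stream :: "stream \<Rightarrow> stream \<Rightarrow> stream" where
  "mul_stream x y =
    (if y \<in> range num then ((\<lambda>z. add_stream z x) ^^ inv num y) (num 0) else (\<lambda>_. True))"

definition nth_stream :: "stream \<Rightarrow> stream \<Rightarrow> bool" where
  "nth_stream x y \<longleftrightarrow> y \<in> range num \<and> x (inv num y)"

definition apply_stream :: "(nat \<Rightarrow> nat) \<Rightarrow> stream \<Rightarrow> stream" where
  "apply_stream f x = num (f (inv num x))"

lemma ones_cons: "case_nat True (\<lambda>_. True) = (\<lambda>_. True :: bool)"
  by (auto simp: fun_eq_iff split: nat.split)

lemma cons_num_iff [simp]: "case_nat True x \<in> range num \<longleftrightarrow> x \<in> range num"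
proof
  assume "case_nat True x \<in> range num"
  then obtain n where n: "case_nat True x = num n" by blast
  then obtain m where "n = Suc m" by (cases n) (auto simp: num_0 dest: fun_cong[of _ _ 0])
  with n show "x \<in> range num" by (auto simp: num_Suc case_nat_eq_iff comp_def)
qed (auto simp: num_Suc[symmetric])

lemma cons_False_num_iff: "case_nat False x \<in> range num \<longleftrightarrow> x = num 0"
proof
  assume "case_nat False x \<in> range num"
  then obtain n where n: "case_nat False x = num n" by blast
  then have "n = 0" by (cases n) (auto simp: num_Suc dest: fun_cong[of _ _ 0])
  with n show "x = num 0" by (auto simp: num_0 case_nat_eq_iff comp_def)
next
  assume "x = num 0"
  then have "case_nat False x = num 0" by (auto simp: num_0 fun_eq_iff split: nat.split)
  then show "case_nat False x \<in> range num" by blast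
qed

lemma case_nat_num_0: "case_nat False (num 0) = num 0"
  by (auto simp: num_0 fun_eq_iff split: nat.split)

lemma inv_num_cons [simp]: "x \<in> range num \<Longrightarrow> inv num (case_nat True x) = Suc (inv num x)"
  by (auto simp: num_Suc[symmetric])

lemma ones_not_num: "(\<lambda>_. True) \<notin> range num"
  using num_neq_ones by (metis imageE)

lemma stream_recursion:
  "add_stream x (num 0) = x"
  "add_stream x (case_nat True y) = case_nat True (add_stream x y)"
  "mul_stream x (num 0) = num 0"
  "mul_stream x (case_nat True y) = add_stream (mul_stream x y) x"
  "nth_stream x (num 0) = x 0"
  "nth_stream x (case_nat True y) = nth_stream (x \<circ> Suc) y"
proof -
  \<comment> \<open>Outside the numbers, the recursion equation for multiplication reduces to this
    absorption law.\<close>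
  have ones: "add_stream (\<lambda>_. True) x = (\<lambda>_. True)"
  proof -
    have "(case_nat True ^^ n) (\<lambda>_. True) = (\<lambda>_. True)" for n
      by (induction n) (simp_all add: ones_cons)
    then show ?thesis by (simp add: add_stream_def)
  qed
  show "add_stream x (num 0) = x" "mul_stream x (num 0) = num 0" "nth_stream x (num 0) = x 0"
    by (simp_all add: add_stream_def mul_stream_def nth_stream_def)
  show "add_stream x (case_nat True y) = case_nat True (add_stream x y)"
    by (simp add: add_stream_def ones_cons)
  show "mul_stream x (case_nat True y) = add_stream (mul_stream x y) x"
    by (simp add: mul_stream_def ones)
  show "nth_stream x (case_nat True y) = nth_stream (x \<circ> Suc) y"
    by (auto simp: nth_stream_def)
qed

text \<open>The equations instantiate variables by arbitrary streams, where \<open>holds\<close> has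
  no meaning. \<open>nval\<close> and \<open>fval\<close> extend the semantics to such assignments,
  while quantifiers still range over numbers.\<close>

fun nval :: "(nat \<Rightarrow> nat) \<Rightarrow> (nat \<Rightarrow> nat) \<Rightarrow> (nat \<Rightarrow> stream) \<Rightarrow> nterm \<Rightarrow> stream" where
  "nval f g X (NVar x) = X x"
| "nval f g X NZero = num 0"
| "nval f g X (NSuc a) = case_nat True (nval f g X a)"
| "nval f g X (NAdd a b) = add_stream (nval f g X a) (nval f g X b)"
| "nval f g X (NMul a b) = mul_stream (nval f g X a) (nval f g X b)"
| "nval f g X (NApp i a) = (if i = 0 then apply_stream f (nval f g X a)
     else if i = 1 then apply_stream g (nval f g X a) else num 0)"

fun fval :: "(nat \<Rightarrow> nat) \<Rightarrow> (nat \<Rightarrow> nat) \<Rightarrow> (nat \<Rightarrow> stream) \<Rightarrow> arith_form \<Rightarrow> bool" where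
  "fval f g X (Eq a b) \<longleftrightarrow> nval f g X a = nval f g X b"
| "fval f g X (Neg \<phi>) \<longleftrightarrow> \<not> fval f g X \<phi>"
| "fval f g X (Conj \<phi> \<psi>) \<longleftrightarrow> fval f g X \<phi> \<and> fval f g X \<psi>"
| "fval f g X (All x \<phi>) \<longleftrightarrow> (\<forall>n. fval f g (X(x := num n)) \<phi>)"

lemma nval_cong: "(\<And>i. i < nbound a \<Longrightarrow> X i = Y i) \<Longrightarrow> nval f g X a = nval f g Y a"
  by (induction a) auto

lemma fval_cong: "(\<And>i. i < fbound \<phi> \<Longrightarrow> X i = Y i) \<Longrightarrow> fval f g X \<phi> \<longleftrightarrow> fval f g Y \<phi>"
proof (induction \<phi> arbitrary: X Y)
  case (Eq a b)
  have "nval f g X a = nval f g Y a" "nval f g X b = nval f g Y b"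
    by (rule nval_cong; use Eq in simp)+
  then show ?case by simp
next
  case (Neg \<phi>)
  have "fval f g X \<phi> \<longleftrightarrow> fval f g Y \<phi>"
    by (rule Neg.IH) (use Neg.prems in simp)
  then show ?case by simp
next
  case (Conj \<phi> \<psi>)
  have "fval f g X \<phi> \<longleftrightarrow> fval f g Y \<phi>" "fval f g X \<psi> \<longleftrightarrow> fval f g Y \<psi>"
    by (rule Conj.IH; use Conj.prems in simp)+
  then show ?case by simp
next
  case (All x \<phi>)
  have "fval f g (X(x := num n)) \<phi> \<longleftrightarrow> fval f g (Y(x := num n)) \<phi>" for n
    by (rule All.IH) (use All.prems in auto)
  then show ?case by simp
qed

section \<open>The standard model\<close>

fun bit_of :: "val \<Rightarrow> bool" where
  "bit_of (BitVal b) = b"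
| "bit_of (StreamVal x) = False"

fun stream_of :: "val \<Rightarrow> stream" where
  "stream_of (BitVal b) = (\<lambda>_. False)"
| "stream_of (StreamVal x) = x"

locale standard_model =
  fixes \<sigma> :: stream and f g :: "nat \<Rightarrow> nat" and n :: nat
  assumes graph: "\<And>x y. \<sigma> (pp x y) \<Longrightarrow> \<sigma> (pp x (f x))"
begin

text \<open>In the last case the formula is decoded from the name, and its variable \<open>j\<close>
  is read off argument \<open>j\<close>. By \<open>fval_cong\<close>, positions past the end of the
  list do not matter once \<open>fbound\<close> is at most the arity.\<close>

definition bit_op :: "nat \<Rightarrow> val list \<Rightarrow> bool" where
  "bit_op i vs = (let x = stream_of (vs ! 0); y = stream_of (vs ! 1) in
     if i = 6 then x 0 else if i = 8 then x \<in> range num else if i = 11 then x = y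
     else if i = 12 then nth_stream x y
     else if i = 15 then (if bit_of (vs ! 0) then bit_of (vs ! 1) else bit_of (vs ! 2))
     else fval f g (\<lambda>j. stream_of (vs ! j)) (from_nat (i - 17)))"

definition stream_op :: "nat \<Rightarrow> val list \<Rightarrow> stream" where
  "stream_op i vs = (let x = stream_of (vs ! 0); y = stream_of (vs ! 1) in
     if i = 2 then num 0 else if i = 3 then (\<lambda>_. True) else if i = 4 then \<sigma>
     else if i = 5 then num n else if i = 7 then x \<circ> Suc else if i = 9 then apply_stream f x
     else if i = 10 then apply_stream g x else if i = 13 then add_stream x y
     else if i = 14 then mul_stream x y
     else if i = 16 then (if bit_of (vs ! 0) then y else stream_of (vs ! 2))
     else (case from_nat (i - 17) of
       All x \<phi> \<Rightarrow> num (SOME m. \<not> fval f g ((\<lambda>j. stream_of (vs ! j))(x := num m)) \<phi>)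
     | _ \<Rightarrow> num 0))"

fun J :: "symbol \<Rightarrow> val list \<Rightarrow> val" where
  "J Zero vs = BitVal False"
| "J One vs = BitVal True"
| "J Cons vs = StreamVal (case_nat (bit_of (vs ! 0)) (stream_of (vs ! 1)))"
| "J (Fun i ss BitSort) vs = BitVal (bit_op i vs)"
| "J (Fun i ss StreamSort) vs = StreamVal (stream_op i vs)"

lemma J_closed: "J s vs \<in> carrier UNIV (res_sort s)"
  by (cases "(s, vs)" rule: J.cases) auto

lemma alg: "stream_algebra \<Sigma> UNIV J"
  using J_closed by (auto simp: stream_algebra_def)

lemma base_eqs_hold:
  "(l, r) \<in> set base_eqs \<Longrightarrow> eval_trm J (env X b) l = eval_trm J (env X b) r"
proof -
  have pp: "add_stream (mul_stream (add_stream (num x) (num y)) (add_stream (num x) (num y))) (num x)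
    = num (pp x y)" for x y
  proof -
    have add: "add_stream (num x) (num y) = num (x + y)" for x y
      by (induction y) (simp_all add: stream_recursion num_Suc)
    have mul: "mul_stream (num x) (num y) = num (x * y)" for x y
      by (induction y) (simp_all add: stream_recursion num_Suc add add.commute)
    show ?thesis by (simp add: add mul pp_def)
  qed
  have graph': "nth_stream \<sigma> (num (pp x y)) \<Longrightarrow> nth_stream \<sigma> (num (pp x (f x)))" for x y
    using graph by (auto simp: nth_stream_def)
  have "list_all (\<lambda>(l, r). eval_trm J (env X b) l = eval_trm J (env X b) r) base_eqs"
    unfolding base_eqs_def using graph'
    by (auto simp: Let_def case_nat_num_0 bit_op_def stream_op_def stream_recursion cons_False_num_iff ones_not_num
        ones_cons case_nat_stream apply_stream_def pp)
  then show "(l, r) \<in> set base_eqs \<Longrightarrow> eval_trm J (env X b) l = eval_trm J (env X b) r"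
    by (auto simp: list_all_iff)
qed

lemma ntrm_nval: "eval_trm J (env X b) (ntrm a) = StreamVal (nval f g X a)"
  by (induction a) (simp_all add: stream_op_def)

lemma truth_value: "J (truthF K \<phi>) vs = BitVal (fval f g (\<lambda>j. stream_of (vs ! j)) \<phi>)"
  by (simp add: bit_op_def)

lemma ftrm_fval: "fbound \<phi> \<le> K \<Longrightarrow> eval_trm J (env X b) (ftrm K \<phi>) = BitVal (fval f g X \<phi>)"
proof (induction \<phi>)
  case (All x \<phi>)
  have "fval f g (\<lambda>j. stream_of (map (eval_trm J (env X b)) (map SV [0..<K]) ! j)) (All x \<phi>) \<longleftrightarrow>
      fval f g X (All x \<phi>)"
    by (rule fval_cong) (use All.prems in auto)
  then show ?case by (simp only: ftrm.simps eval_trm.simps truth_value)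
qed (simp_all add: ntrm_nval bit_op_def)

lemma truth_eqs_hold:
  "fbound \<phi> \<le> K \<Longrightarrow> (l, r) \<in> set (truth_eqs K \<phi>) \<Longrightarrow>
    eval_trm J (env X b) l = eval_trm J (env X b) r"
proof (induction \<phi>)
  case (All x \<phi>)
  define xs where "xs = map SV ([0..<K][x := K])"
  define Y where "Y j = stream_of (map (eval_trm J (env X b)) xs ! j)" for j
  have x: "x < K" "fbound \<phi> \<le> K" using All.prems(1) by auto
  \<comment> \<open>Below \<open>K\<close>, \<open>Y\<close> can differ from \<open>X\<close> only
    at \<open>x\<close>, where it holds \<open>X K\<close>; both updates overwrite that
    place.\<close>
  have Y: "fval f g (Y(x := num m)) \<phi> \<longleftrightarrow> fval f g (X(x := num m)) \<phi>" for m
    by (rule fval_cong) (use x in \<open>auto simp: Y_def xs_def nth_list_update\<close>)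
  have truth: "eval_trm J (env X b) (App (truthF K (All x \<phi>)) xs) =
      BitVal (\<forall>m. fval f g (X(x := num m)) \<phi>)"
    unfolding eval_trm.simps truth_value Y_def[symmetric] by (simp add: Y)
  have witness: "eval_trm J (env X b) (App (witnessF K (All x \<phi>)) xs) =
      StreamVal (num (SOME m. \<not> fval f g (X(x := num m)) \<phi>))"
    unfolding eval_trm.simps J.simps stream_op_def Let_def
    by (simp add: Y_def[symmetric] Y)
  consider "l = impT (App (truthF K (All x \<phi>)) xs) (impT (isnatT (SV x)) (ftrm K \<phi>))" "r = T1"
    | "l = impT (eqT (SV x) (App (witnessF K (All x \<phi>)) xs))
        (impT (notT (App (truthF K (All x \<phi>)) xs)) (andT (isnatT (SV x)) (notT (ftrm K \<phi>))))" "r = T1"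
    | "(l, r) \<in> set (truth_eqs K \<phi>)"
    using All.prems(2) unfolding truth_eqs.simps Let_def xs_def by auto
  then show ?case
  proof cases
    case 1
    \<comment> \<open>The equation evaluates the body under \<open>X\<close> itself, which equals
      its own update once \<open>X x\<close> is a number.\<close>
    have "fval f g X \<phi>" if "\<forall>m. fval f g (X(x := num m)) \<phi>" "X x = num m" for m
      using that by (metis fun_upd_triv)
    then show ?thesis
      using truth ftrm_fval[OF x(2)] unfolding 1 eval_trm.simps(2)[of _ _ ifbF] list.map
      by (auto simp: bit_op_def)
  next
    case 2
    have "\<not> fval f g X \<phi>"
      if "\<not> fval f g (X(x := num m)) \<phi>" "X x = num (SOME m. \<not> fval f g (X(x := num m)) \<phi>)" for m
      using that someI[of "\<lambda>m. \<not> fval f g (X(x := num m)) \<phi>"] by (metis fun_upd_triv)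
    then show ?thesis
      using truth witness ftrm_fval[OF x(2)] unfolding 2 eval_trm.simps(2)[of _ _ ifbF]
        eval_trm.simps(2)[of _ _ eqF] list.map
      by (auto simp: bit_op_def)
  next
    case 3
    with All.IH[OF x(2)] show ?thesis by blast
  qed
qed auto

lemma truth_model:
  assumes "fbound \<phi> \<le> K"
  shows "truth_model (set (spec_syms K \<phi>)) UNIV J
    ((App numF [], numeral_trm n) # base_eqs @ truth_eqs K \<phi>)" (is "truth_model _ _ _ ?E")
proof
  show "models UNIV J (set ?E)"
    unfolding models_def
  proof (intro allI impI ballI)
    fix \<alpha> :: "nat \<Rightarrow> srt \<Rightarrow> val" and eq assume \<alpha>: "\<forall>x s. \<alpha> x s \<in> carrier UNIV s" and eq: "eq \<in> set ?E"
    obtain X b where X: "\<alpha> = env X b" 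
      by (rule env_exhaust[OF \<alpha>[rule_format]])
    have "eval_trm J \<alpha> (numeral_trm m) = StreamVal (num m)" for m
      by (induction m) (simp_all add: stream_op_def num_Suc)
    then have "eval_trm J \<alpha> (App numF []) = eval_trm J \<alpha> (numeral_trm n)"
      by (simp add: stream_op_def)
    with eq show "case eq of (l, r) \<Rightarrow> eval_trm J \<alpha> l = eval_trm J \<alpha> r"
      unfolding X using base_eqs_hold truth_eqs_hold[OF assms] by auto
  qed
  show "set (syms l) \<union> set (syms r) \<subseteq> set (spec_syms K \<phi>)" if "(l, r) \<in> set ?E" for l r
    using that by (intro syms_spec_eqs[of _ _ K \<phi> n]) (auto simp: spec_eqs_def)
  show "set base_eqs \<subseteq> set ?E" by auto
qed (rule alg, rule syms_base_eqs)

text \<open>Two evaluations of the same term are compared: \<open>ftrm_fval\<close> yields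
  \<open>fval\<close> and \<open>ftrm_eval\<close> yields \<open>holds\<close>. So the two agree at
  numbers without a further induction on formulas.\<close>

lemma root_eq_holds:
  assumes "fbound \<phi> \<le> K" and holds: "holds ((\<lambda>_ _. 0)(0 := f, 1 := g)) ((\<lambda>_. 0)(0 := n)) \<phi>"
  shows "eval_trm J (env X b) (guarded [0..<K] (ftrm K \<phi>)) = BitVal True"
proof -
  interpret truth_model "set (spec_syms K \<phi>)" UNIV J
    "(App numF [], numeral_trm n) # base_eqs @ truth_eqs K \<phi>"
    by (rule truth_model[OF assms(1)])
  let ?F = "(\<lambda>_ _. 0)(0 := f, 1 := g) :: nat \<Rightarrow> nat \<Rightarrow> nat"
  define e :: "nat \<Rightarrow> nat" where "e = (\<lambda>_. 0)(0 := n)"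
  have F: "J uniF [StreamVal (num m)] = StreamVal (num (?F 0 m))"
    "J exF [StreamVal (num m)] = StreamVal (num (?F 1 m))"
    "\<forall>i \<ge> 2. \<forall>n. ?F i n = 0" for m
    by (simp_all add: stream_op_def apply_stream_def)
  have "BitVal (fval f g (\<lambda>i. num (e i)) \<phi>) = eval_trm J (env (\<lambda>i. num (e i)) b) (ftrm K \<phi>)"
    by (rule ftrm_fval[OF assms(1), symmetric])
  also have "\<dots> = BitVal (holds ?F e \<phi>)"
    by (rule ftrm_eval[where F = ?F, OF F assms(1)]) auto
  finally have "fval f g (\<lambda>i. num (e i)) \<phi>" using holds by (simp add: e_def)
  moreover have "fval f g X \<phi> \<longleftrightarrow> fval f g (\<lambda>i. num (e i)) \<phi>"
    if "\<forall>i \<in> set [0..<K]. X i = num (if i = 0 then n else 0)"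
    by (rule fval_cong) (use that assms(1) in \<open>auto simp: e_def\<close>)
  ultimately show ?thesis
    using guarded_eval[of n X b "ftrm K \<phi>" "fval f g X \<phi>" "[0..<K]"] ftrm_fval[OF assms(1)]
    by (auto simp: stream_op_def)
qed

lemma arg_in_solutions:
  assumes "fbound \<phi> \<le> K" "holds ((\<lambda>_ _. 0)(0 := f, 1 := g)) ((\<lambda>_. 0)(0 := n)) \<phi>"
  shows "\<sigma> \<in> solutions (truth_spec K \<phi> n)"
proof -
  have "models UNIV J (set ((App numF [], numeral_trm n) # base_eqs @ truth_eqs K \<phi>))"
    using truth_model[OF assms(1)] by (simp add: truth_model_def)
  moreover have "models UNIV J {root_eq K \<phi>}"
    unfolding models_def root_eq_def
  proof (intro allI impI)
    fix \<alpha> :: "nat \<Rightarrow> srt \<Rightarrow> val" assume \<alpha>: "\<forall>x s. \<alpha> x s \<in> carrier UNIV s"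
    obtain X b where "\<alpha> = env X b"
      by (rule env_exhaust[OF \<alpha>[rule_format]])
    then show "\<forall>(l, r) \<in> {(guarded [0..<K] (ftrm K \<phi>), T1)}. eval_trm J \<alpha> l = eval_trm J \<alpha> r"
      using root_eq_holds[OF assms] by simp
  qed
  ultimately have "models UNIV J (set (spec_eqs K \<phi> n))"
    by (auto simp: models_def spec_eqs_def)
  moreover have "eval_trm J (\<lambda>_ _. undefined) (App argF []) = StreamVal \<sigma>"
    by (simp add: stream_op_def)
  ultimately show ?thesis using alg unfolding truth_spec_def solutions.simps sol_def by blast
qed

end

section \<open>Solution sets of the specifications\<close>

lemma solutions_truth_spec:
  assumes K: "fbound \<phi> \<le> K"
  shows "solutions (truth_spec K \<phi> n) = {\<sigma>. \<exists>f g. (\<forall>x y. \<sigma> (pp x y) \<longrightarrow> \<sigma> (pp x (f x))) \<and>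
    holds ((\<lambda>_ _. 0)(0 := f, 1 := g)) ((\<lambda>_. 0)(0 := n)) \<phi>}"
proof (intro set_eqI iffI; unfold mem_Collect_eq)
  fix \<sigma> assume "\<sigma> \<in> solutions (truth_spec K \<phi> n)"
  then obtain AS I where alg: "stream_algebra (set (spec_syms K \<phi>)) AS I"
    and mod: "models AS I (set (spec_eqs K \<phi> n))" and \<sigma>: "I argF [] = StreamVal \<sigma>"
    by (auto simp: truth_spec_def sol_def)
  interpret truth_model "set (spec_syms K \<phi>)" AS I "spec_eqs K \<phi> n"
  proof
    show "set base_eqs \<subseteq> set (spec_eqs K \<phi> n)" by (auto simp: spec_eqs_def)
  qed (rule alg, rule mod, erule syms_spec_eqs, rule syms_base_eqs)
  obtain f where f: "\<And>n. I uniF [StreamVal (num n)] = StreamVal (num (f n))" using uni by blast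
  obtain g where g: "\<And>n. I exF [StreamVal (num n)] = StreamVal (num (g n))" using ex by blast
  let ?F = "(\<lambda>_ _. 0)(0 := f, 1 := g) :: nat \<Rightarrow> nat \<Rightarrow> nat"
  have F: "I uniF [StreamVal (num m)] = StreamVal (num (?F 0 m))"
    "I exF [StreamVal (num m)] = StreamVal (num (?F 1 m))"
    "\<forall>i \<ge> 2. \<forall>n. ?F i n = 0" for m
    using f g by simp_all
  have "eval_trm I (env (\<lambda>_. num 0) b) (App numF []) = eval_trm I (env (\<lambda>_. num 0) b) (numeral_trm n)" for b
    by (rule env_eq) (auto simp: spec_eqs_def num_closed)
  then have "I numF [] = StreamVal (num n)" by (simp add: numeral_eval)
  then have "holds ?F ((\<lambda>_. 0)(0 := n)) \<phi>"
    by (rule root_sound[where F = ?F, OF F _ K]) (auto simp: spec_eqs_def)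
  then show "\<exists>f g. (\<forall>x y. \<sigma> (pp x y) \<longrightarrow> \<sigma> (pp x (f x))) \<and>
      holds ((\<lambda>_ _. 0)(0 := f, 1 := g)) ((\<lambda>_. 0)(0 := n)) \<phi>"
    using arg_graph[OF \<sigma> f] by blast
next
  fix \<sigma> assume "\<exists>f g. (\<forall>x y. \<sigma> (pp x y) \<longrightarrow> \<sigma> (pp x (f x))) \<and>
    holds ((\<lambda>_ _. 0)(0 := f, 1 := g)) ((\<lambda>_. 0)(0 := n)) \<phi>"
  then obtain f g where graph: "\<And>x y. \<sigma> (pp x y) \<Longrightarrow> \<sigma> (pp x (f x))"
    and holds: "holds ((\<lambda>_ _. 0)(0 := f, 1 := g)) ((\<lambda>_. 0)(0 := n)) \<phi>" by blast
  interpret standard_model \<sigma> f g n by standard (rule graph)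
  show "\<sigma> \<in> solutions (truth_spec K \<phi> n)" by (rule arg_in_solutions[OF K holds])
qed

definition free_spec :: spec_term where
  "free_spec = ([Zero, One, Cons, argF], [], App argF [])"

lemma valid_free_spec: "valid_spec_term free_spec"
  by (simp add: free_spec_def bitstream_signature_def bitstream_spec_def)

lemma solutions_free_spec: "solutions free_spec = UNIV"
proof -
  have "\<sigma> \<in> solutions free_spec" for \<sigma>
  proof -
    \<comment> \<open>A choice function for the relation given by \<open>\<sigma>\<close> meets the
      locale assumption, whichever stream \<open>\<sigma>\<close> is.\<close>
    interpret standard_model \<sigma> "\<lambda>x. SOME y. \<sigma> (pp x y)" "\<lambda>_. 0" 0
      by standard (rule someI)
    have "models UNIV J (set [])" by (simp add: models_def)
    moreover have "eval_trm J (\<lambda>_ _. undefined) (App argF []) = StreamVal \<sigma>"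
      by (simp add: stream_op_def)
    ultimately show ?thesis using alg unfolding free_spec_def solutions.simps sol_def by blast
  qed
  then show ?thesis by blast
qed

lemma solutions_truth_spec_UNIV:
  assumes "fbound \<phi> \<le> K"
  shows "solutions (truth_spec K \<phi> n) = UNIV \<longleftrightarrow>
    (\<forall>f. \<exists>g. holds ((\<lambda>_ _. 0)(0 := f, 1 := g)) ((\<lambda>_. 0)(0 := n)) \<phi>)"
proof
  assume UNIV: "solutions (truth_spec K \<phi> n) = UNIV"
  show "\<forall>f. \<exists>g. holds ((\<lambda>_ _. 0)(0 := f, 1 := g)) ((\<lambda>_. 0)(0 := n)) \<phi>"
  proof
    fix f :: "nat \<Rightarrow> nat"
    \<comment> \<open>Each fibre of the graph is a singleton, so a compatible function can only be
      \<open>f\<close>.\<close>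
    define \<sigma> where "\<sigma> k \<longleftrightarrow> (\<exists>x. k = pp x (f x))" for k
    obtain f' g where f': "\<And>x y. \<sigma> (pp x y) \<Longrightarrow> \<sigma> (pp x (f' x))"
      and g: "holds ((\<lambda>_ _. 0)(0 := f', 1 := g)) ((\<lambda>_. 0)(0 := n)) \<phi>"
      using UNIV solutions_truth_spec[OF assms, of n] by blast
    have "f' x = f x" for x
      using f'[of x "f x"] by (auto simp: \<sigma>_def)
    then have "f' = f" by blast
    with g show "\<exists>g. holds ((\<lambda>_ _. 0)(0 := f, 1 := g)) ((\<lambda>_. 0)(0 := n)) \<phi>" by blast
  qed
next
  assume *: "\<forall>f. \<exists>g. holds ((\<lambda>_ _. 0)(0 := f, 1 := g)) ((\<lambda>_. 0)(0 := n)) \<phi>"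
  have "\<sigma> \<in> solutions (truth_spec K \<phi> n)" for \<sigma>
  proof -
    \<comment> \<open>Where no \<open>y\<close> is related to \<open>x\<close>, the chosen value is
      arbitrary and compatibility holds vacuously.\<close>
    define f where "f x = (SOME y. \<sigma> (pp x y))" for x
    have "\<forall>x y. \<sigma> (pp x y) \<longrightarrow> \<sigma> (pp x (f x))" unfolding f_def by (metis someI)
    moreover obtain g where "holds ((\<lambda>_ _. 0)(0 := f, 1 := g)) ((\<lambda>_. 0)(0 := n)) \<phi>"
      using * by blast
    ultimately show ?thesis unfolding solutions_truth_spec[OF assms] mem_Collect_eq
      by (intro exI conjI)
  qed
  then show "solutions (truth_spec K \<phi> n) = UNIV" by blast
qed

section \<open>Hardness\<close>

lemma recursive_list_encode:
  assumes "\<And>F. F \<in> set Fs \<Longrightarrow> recursive k F"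
  shows "recursive k (\<lambda>xs. list_encode (map (\<lambda>F. F xs) Fs))"
  using assms
  by (induction Fs) (auto intro!: recursive_const recursive_Suc recursive_prod_encode)

text \<open>The successor step wraps the previous code in fixed material, so primitive recursion
  applies directly to codes.\<close>

lemma recursive_code_numeral_trm: "recursive 1 (\<lambda>xs. code_trm (numeral_trm (xs ! 0)))"
proof -
  have "recursive (Suc 0) (\<lambda>xs. code_trm (numeral_trm (xs ! 0)))"
  proof (rule recursive_primrec[where G = "\<lambda>_. code_trm zerosT" and
        H = "\<lambda>xs. Suc (prod_encode (1, Suc (prod_encode (code_symbol Cons,
          list_encode (map (\<lambda>F. F xs) [\<lambda>_. code_trm T1, \<lambda>xs. xs ! 1])))))"])
    show "recursive (Suc (Suc 0)) (\<lambda>xs. Suc (prod_encode (1, Suc (prod_encode (code_symbol Cons,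
          list_encode (map (\<lambda>F. F xs) [\<lambda>_. code_trm T1, \<lambda>xs. xs ! 1]))))))"
      by (intro recursive_Suc recursive_prod_encode recursive_const recursive_list_encode)
        (auto intro: recursive_const recursive_proj)
  qed (simp_all add: recursive_const)
  then show ?thesis by simp
qed

lemma recursive_code_instance:
  "recursive 1 (\<lambda>xs. code_instance (free_spec, truth_spec K \<phi> (xs ! 0)))"
proof -
  let ?c = "map (\<lambda>eq _. code_equation eq) (base_eqs @ truth_eqs K \<phi> @ [root_eq K \<phi>])"
  let ?E = "(\<lambda>xs. prod_encode (code_trm (App numF []), code_trm (numeral_trm (xs ! 0)))) # ?c"
  have "recursive 1 (\<lambda>xs. list_encode (map (\<lambda>F. F xs) ?E))"
  proof (rule recursive_list_encode)
    have "recursive 1 (\<lambda>xs. prod_encode (code_trm (App numF []), code_trm (numeral_trm (xs ! 0))))"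
      by (intro recursive_prod_encode recursive_const recursive_code_numeral_trm)
    moreover have "recursive 1 F" if "F \<in> set ?c" for F
      using that recursive_const by auto
    ultimately show "recursive 1 F" if "F \<in> set ?E" for F
      using that by (metis set_ConsD)
  qed
  then have "recursive 1 (\<lambda>xs. prod_encode (code_spec_term free_spec,
    list_encode (map (\<lambda>F. F xs) [\<lambda>_. list_encode (map code_symbol (spec_syms K \<phi>)),
      \<lambda>xs. list_encode (map (\<lambda>F. F xs) ?E), \<lambda>_. code_trm (App argF [])])))"
    by (intro recursive_prod_encode recursive_const recursive_list_encode)
      (auto simp only: list.set intro: recursive_const)
  then show ?thesis
    by (simp add: truth_spec_def spec_eqs_def comp_def
        del: code_trm.simps code_symbol.simps list_encode.simps)
qed

lemma sol_equality_problem_iff: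
  "valid_spec_term p \<Longrightarrow> valid_spec_term q \<Longrightarrow>
    code_instance (p, q) \<in> sol_equality_problem \<longleftrightarrow> solutions p = solutions q"
  unfolding sol_equality_problem_def using injD[OF inj_code_instance] by blast

lemma sol_equality_problem_hard:
  assumes "P \<in> Pi12"
  shows "many_one_reducible P sol_equality_problem"
proof -
  obtain \<phi> where P: "\<And>n. n \<in> P \<longleftrightarrow>
      (\<forall>f. \<exists>g. holds ((\<lambda>_ _. 0)(0 := f, 1 := g)) ((\<lambda>_. 0)(0 := n)) \<phi>)"
    using assms unfolding Pi12_def by blast
  show ?thesis
  proof (rule many_one_reducible_total[OF recursive_code_instance])
    fix n
    show "n \<in> P \<longleftrightarrow> code_instance (free_spec, truth_spec (fbound \<phi>) \<phi> n) \<in> sol_equality_problem"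
      unfolding sol_equality_problem_iff[OF valid_free_spec valid_truth_spec] solutions_free_spec P
      using solutions_truth_spec_UNIV[of \<phi> "fbound \<phi>" n] by auto
  qed
qed

theorem theorem7:
  shows "complete_for Pi12 sol_equality_problem"
  unfolding complete_for_def
  using sol_equality_problem_hard sol_equality_problem_in_Pi12 many_one_reducible_refl by blast

end
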